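(* Let $s(t)$, $t\in\mathbb{R}$, be a circularly symmetric complex-valued, bandlimited, wide-sense stationary Gaussian stochastic process with zero mean and spectral density $\mathcal{S}_s(f)=1$ for $f\in[-B/2,B/2]$ and $\mathcal{S}_s(f)=0$ otherwise, where $B>0$. Let $0\le t_1<t_2<\dots<t_N$, with $N\ge 3$, be fixed real sampling times, and let $\tau_0,\omega_0\in\mathbb{R}$ be fixed. Define the random vector \[ \mathbf{v}=\big(s(t_1-\tau_0)e^{i\omega_0 t_1},\dots,s(t_N-\tau_0)e^{i\omega_0 t_N}\big)^T\in\mathbb{C}^N \] and the random field \[ \mathbf{w}(\tau,\omega)=\big(s(t_1-\tau)e^{i\omega t_1},\dots,s(t_N-\tau)e^{i\omega t_N}\big)^T\in\mathbb{C}^N,\qquad (\tau,\omega)\in\mathbb{R}^2 . \] Let $T=T_3\times\mathbb{R}$, where $T_3\subset\mathbb{R}$ is a finite union of pairwise disjoint, nonempty, bounded, closed intervals, none of which contains $\tau_0$. Then $\mathbf{v}$ and $\mathbf{w}(\tau,\omega)$ are linearly independent for all $(\tau,\omega)\in T$ with probability one, i.e. \[ \mathrm{Prob}\Big(\exists\,(\tau,\omega)\in T:\ \operatorname{rank}\begin{pmatrix}\mathbf{v} & \mathbf{w}(\tau,\omega)\end{pmatrix}=1\Big)=0 . \]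
   Context: Here $i$ denotes the imaginary unit. "Circularly symmetric" means $e^{i\phi}s(\cdot)$ has the same distribution as $s(\cdot)$ for every real $\phi$ (equivalently, for the zero-mean Gaussian process, $\mathbb{E}[s(t)s(t')]=0$ for all $t,t'$). The spectral density is related to the covariance by $\mathbb{E}[s(t)\overline{s(t')}]=\int_{\mathbb{R}} e^{i f (t-t')}\mathcal{S}_s(f)\,df$. $\operatorname{rank}\begin{pmatrix}\mathbf{v} & \mathbf{w}\end{pmatrix}$ denotes the rank of the $N\times 2$ complex matrix with columns $\mathbf{v}$ and $\mathbf{w}$.
   Formalization: The formal theorem additionally assumes that almost every sample path of s is continuous; without path regularity the claim fails for modifications of s altered at random times. The conclusion proved is the displayed formula (rank = 1 has probability zero). *)

theory Defs
  imports "HOL-Probability.Probability" "Jordan_Normal_Form.DL_Rank"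
begin

definition real_gaussian_rv :: "'w measure \<Rightarrow> ('w \<Rightarrow> real) \<Rightarrow> bool" where
  "real_gaussian_rv M X \<longleftrightarrow> X \<in> borel_measurable M \<and>
     ((\<exists>\<mu> \<sigma>. \<sigma> > 0 \<and> distributed M lborel X (normal_density \<mu> \<sigma>)) \<or>
      (\<exists>c. AE x in M. X x = c))"

text \<open>A complex-valued process is (jointly) Gaussian if every finite real-linear
  combination of the real and imaginary parts of its values is a real Gaussian
  random variable; such a combination is exactly Re (sum c_k s(t_k)) with complex c_k.\<close>
definition complex_gaussian_process :: "'w measure \<Rightarrow> (real \<Rightarrow> 'w \<Rightarrow> complex) \<Rightarrow> bool" where
  "complex_gaussian_process M s \<longleftrightarrow>
     (\<forall>t. s t \<in> borel_measurable M) \<and>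
     (\<forall>(ts :: real list) (cs :: complex list). length cs = length ts \<longrightarrow>
        real_gaussian_rv M (\<lambda>x. Re (\<Sum>k<length ts. cs ! k * s (ts ! k) x)))"

definition lowpass_density :: "real \<Rightarrow> real \<Rightarrow> complex" where
  "lowpass_density B f = (if f \<in> {-B/2..B/2} then 1 else 0)"

text \<open>Covariance associated with a spectral density S:
  E[s(t) conj(s(t'))] = integral of exp(i f (t - t')) S(f) df.\<close>
definition spectral_cov :: "(real \<Rightarrow> complex) \<Rightarrow> real \<Rightarrow> complex" where
  "spectral_cov S d = (\<integral>f. exp (\<i> * of_real (f * d)) * S f \<partial>lborel)"

definition sample_mat ::
  "nat \<Rightarrow> (nat \<Rightarrow> real) \<Rightarrow> (real \<Rightarrow> 'w \<Rightarrow> complex) \<Rightarrow> real \<Rightarrow> real \<Rightarrow> real \<Rightarrow> real \<Rightarrow> 'w \<Rightarrow> complex mat" where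
  "sample_mat N t s \<tau>0 \<omega>0 \<tau> \<omega> x = mat N 2 (\<lambda>(k, j).
      if j = 0 then s (t k - \<tau>0) x * exp (\<i> * of_real (\<omega>0 * t k))
      else s (t k - \<tau>) x * exp (\<i> * of_real (\<omega> * t k)))"

end

theory Submission
  imports Defs "HOL-Complex_Analysis.Complex_Analysis"
begin

text \<open>
  Only the first three samples matter. Almost surely \<open>s (t\<^sub>0 - \<tau>0) \<noteq> 0\<close>, so rank one forces, for some
  complex \<open>\<mu>\<close> and \<open>\<nu> = \<omega> - \<omega>0\<close>, the vanishing of the three complex linear combinations
  \<open>s (t\<^sub>k - \<tau>) - \<mu> exp (- i \<nu> t\<^sub>k) s (t\<^sub>k - \<tau>0)\<close>: six real equations in the four real parameters
  \<open>\<tau>\<close>, \<open>\<nu>\<close>, \<open>Re \<mu>\<close>, \<open>Im \<mu>\<close>. For fixed parameters with \<open>\<tau> \<noteq> \<tau>0\<close> these combinations form a nondegenerate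
  Gaussian vector, even if some \<open>t\<^sub>k - \<tau>\<close> coincides with some \<open>t\<^sub>l - \<tau>0\<close>: if \<open>\<tau> > \<tau>0\<close> then \<open>t\<^sub>0 - \<tau>\<close> is
  the smallest of all sampling points and occurs in one combination only, and so on inductively; if
  \<open>\<tau> < \<tau>0\<close> one starts from the largest point. By compactness the covariance is bounded below
  uniformly on bounded parameter sets, so all three combinations are at most \<open>\<epsilon>\<close> with probability
  \<open>O(\<epsilon>\<^sup>6)\<close>. The expected quadratic variation shows by Fatou's lemma that the paths are almost surely
  Hoelder continuous with exponent 1/2, so a grid of mesh \<open>1/n\<^sup>2\<close> in \<open>\<tau>\<close> and \<open>1/n\<close> in the other three
  parameters detects every zero up to an error \<open>O(1/n)\<close>. It has \<open>O(n\<^sup>5)\<close> points, so the probability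
  of a zero is \<open>O(n\<^sup>5 n\<^sup>-\<^sup>6)\<close>.
\<close>

section \<open>Rank one, exponential sums and Hoelder continuity\<close>

text \<open>Linear dependence is a property of the set of columns, so two equal columns form a
  separate case, with coefficients 1 and -1. Distinct columns would have rank 2 if they were
  independent, so rank 1 yields a nonzero kernel vector.\<close>

lemma rank_one_imp_columns_dependent:
  fixes A :: "'a::field mat"
  assumes A: "A \<in> carrier_mat n 2" and rk: "vec_space.rank n A = 1"
  shows "\<exists>\<alpha> \<beta>. (\<alpha> \<noteq> 0 \<or> \<beta> \<noteq> 0) \<and> (\<forall>k<n. \<alpha> * A $$ (k, 0) + \<beta> * A $$ (k, 1) = 0)"
proof (cases "distinct (cols A)")
  case True
  interpret vec_space "TYPE('a)" n .
  have "lin_dep (set (cols A))"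
    using lin_indpt_full_rank[OF A True] rk by auto
  then obtain v where v: "v \<in> carrier_vec 2" "v \<noteq> 0\<^sub>v 2" "A *\<^sub>v v = 0\<^sub>v n"
    using lin_depE[OF A _ True] by blast
  have "v $ 0 \<noteq> 0 \<or> v $ 1 \<noteq> 0"
  proof (rule ccontr)
    assume "\<not> ?thesis"
    then have "v = 0\<^sub>v 2"
      using v(1) by (intro eq_vecI) (auto simp: less_2_cases_iff)
    with v(2) show False by simp
  qed
  moreover have "v $ 0 * A $$ (k, 0) + v $ 1 * A $$ (k, 1) = 0" if "k < n" for k
  proof -
    have "(A *\<^sub>v v) $ k = 0" using v(3) that by simp
    moreover have "(A *\<^sub>v v) $ k = (\<Sum>i\<in>{0..<2}. A $$ (k, i) * v $ i)"
      using A v(1) that by (auto simp: scalar_prod_def intro!: sum.cong)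
    ultimately show ?thesis
      by (simp add: numeral_2_eq_2 mult.commute)
  qed
  ultimately show ?thesis by blast
next
  case False
  have "col A 0 = col A 1"
  proof (rule ccontr)
    assume "col A 0 \<noteq> col A 1"
    then have "distinct (cols A)"
      using A by (auto simp: cols_def numeral_2_eq_2)
    with False show False by simp
  qed
  then have "A $$ (k, 0) = A $$ (k, 1)" if "k < n" for k
    using A that by (metis carrier_matD index_col one_less_numeral_iff semiring_norm(76) zero_less_numeral)
  then have "\<forall>k<n. 1 * A $$ (k, 0) + (-1) * A $$ (k, 1) = 0" by simp
  then show ?thesis by (metis one_neq_zero)
qed

text \<open>In the frequency variable the sum is an entire function. It vanishes on a real segment,
  hence everywhere by the identity theorem; the value at the frequency \<open>- \<i> * z\<close> is
  the claim.\<close>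

lemma exponential_sum_eq_0_extend:
  fixes d :: "'j \<Rightarrow> complex" and u :: "'j \<Rightarrow> real" and l r :: real
  assumes "l < r" and zero: "\<And>f. f \<in> {l..r} \<Longrightarrow> (\<Sum>j\<in>J. d j * cis (f * u j)) = 0"
  shows "(\<Sum>j\<in>J. d j * exp (z * of_real (u j))) = 0"
proof -
  define g where "g = (\<lambda>w::complex. \<Sum>j\<in>J. d j * exp (\<i> * w * of_real (u j)))"
  have "g (- \<i> * z) = 0"
  proof (rule analytic_continuation[where f=g and S=UNIV and U="of_real ` {l..r}" and \<xi>="of_real l"])
    show "g holomorphic_on UNIV"
      unfolding g_def by (intro holomorphic_intros)
    show "complex_of_real l islimpt complex_of_real ` {l..r}"
    proof -
      have "l islimpt {l..r}" using \<open>l < r\<close> by (simp add: islimpt_Icc)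
      then show ?thesis
        by (intro islimpt_isCont_image) (auto simp: eventually_at_filter)
    qed
    show "g w = 0" if w: "w \<in> complex_of_real ` {l..r}" for w
    proof -
      obtain f where f: "f \<in> {l..r}" "w = of_real f" using w by auto
      then show ?thesis
        using zero[OF f(1)] by (simp add: g_def cis_conv_exp mult.assoc)
    qed
  qed auto
  then show ?thesis by (simp add: g_def algebra_simps)
qed

text \<open>Divide by the exponential with the least exponent and let a real argument tend to minus
  infinity: every other summand decays and \<open>d i\<close> is what remains.\<close>

lemma least_exponent_coeff_eq_0:
  fixes d :: "'j \<Rightarrow> complex" and u :: "'j \<Rightarrow> real"
  assumes "finite J" "i \<in> J" and least: "\<And>j. j \<in> J \<Longrightarrow> j \<noteq> i \<Longrightarrow> u i < u j"
    and zero: "\<And>z. (\<Sum>j\<in>J. d j * exp (z * of_real (u j))) = 0"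
  shows "d i = 0"
proof -
  define g where "g = (\<lambda>x::real. \<Sum>j\<in>J. d j * of_real (exp (x * (u j - u i))))"
  have "g = (\<lambda>_. 0)"
  proof
    fix x
    have "g x = of_real (exp (- x * u i)) * (\<Sum>j\<in>J. d j * exp (of_real x * of_real (u j)))"
      unfolding g_def sum_distrib_left
      by (intro sum.cong refl) (simp add: exp_of_real[symmetric] exp_add[symmetric] mult_exp_exp algebra_simps exp_diff exp_minus divide_simps)
    then show "g x = 0" using zero by simp
  qed
  moreover have "(g \<longlongrightarrow> (\<Sum>j\<in>J. if j = i then d j else 0)) at_bot"
    unfolding g_def
  proof (intro tendsto_sum)
    fix j assume j: "j \<in> J"
    show "((\<lambda>x. d j * of_real (exp (x * (u j - u i)))) \<longlongrightarrow> (if j = i then d j else 0)) at_bot"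
    proof (cases "j = i")
      case False
      then have pos: "u j - u i > 0" using least j by simp
      have "filterlim (\<lambda>x. x * (u j - u i)) at_bot at_bot"
        using filterlim_tendsto_pos_mult_at_bot[OF tendsto_const[of "u j - u i"] pos filterlim_ident]
        by (simp add: mult.commute)
      then have "((\<lambda>x. exp (x * (u j - u i))) \<longlongrightarrow> 0) at_bot"
        by (rule filterlim_compose[OF exp_at_bot])
      then have "((\<lambda>x. complex_of_real (exp (x * (u j - u i)))) \<longlongrightarrow> of_real 0) at_bot"
        by (rule tendsto_of_real)
      then have "((\<lambda>x. d j * of_real (exp (x * (u j - u i)))) \<longlongrightarrow> d j * of_real 0) at_bot"
        by (rule tendsto_mult_left)
      with False show ?thesis by simp
    qed simp
  qed
  ultimately have "((\<lambda>x::real. 0) \<longlongrightarrow> d i) at_bot"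
    using assms(1,2) by (simp add: sum.delta)
  then show ?thesis
    by (metis tendsto_const tendsto_unique trivial_limit_at_bot_linorder)
qed

text \<open>Induction on \<open>k\<close>: once the coefficients before \<open>k\<close> vanish,
  \<open>p k\<close> is strictly the smallest exponent left, because \<open>p k < p l < q l\<close>
  for \<open>l > k\<close> and \<open>p k < q k\<close>. The other exponents may coincide with each
  other, so the terms are indexed by a disjoint sum.\<close>

lemma shifted_exponentials_independent_aux:
  fixes p q :: "nat \<Rightarrow> real" and c \<mu> :: "nat \<Rightarrow> complex"
  assumes p: "\<And>k l. k < l \<Longrightarrow> l < n \<Longrightarrow> p k < p l" and pq: "\<And>k. k < n \<Longrightarrow> p k < q k"
    and zero: "\<And>z. (\<Sum>k<n. c k * (exp (z * of_real (p k)) - \<mu> k * exp (z * of_real (q k)))) = 0"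
  shows "k < n \<Longrightarrow> c k = 0"
proof (induction k rule: less_induct)
  case (less k)
  let ?J = "{k..<n} <+> {k..<n}"
  define d where "d = case_sum c (\<lambda>l. - (c l * \<mu> l))"
  have "(\<Sum>j\<in>?J. d j * exp (z * of_real (case_sum p q j))) = 0" for z
  proof -
    have "(\<Sum>j\<in>?J. d j * exp (z * of_real (case_sum p q j))) =
        (\<Sum>l\<in>{k..<n}. c l * (exp (z * of_real (p l)) - \<mu> l * exp (z * of_real (q l))))"
      by (simp add: sum.Plus d_def sum_negf sum_subtractf[symmetric] algebra_simps)
    also have "\<dots> = (\<Sum>l<n. c l * (exp (z * of_real (p l)) - \<mu> l * exp (z * of_real (q l))))"
      using less by (intro sum.mono_neutral_left) auto
    finally show ?thesis using zero by simp
  qed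
  moreover have "case_sum p q (Inl k) < case_sum p q j" if "j \<in> ?J" "j \<noteq> Inl k" for j
    using that p[of k] pq by (cases j) (auto intro: less_trans le_neq_trans elim!: PlusE simp: nat_less_le, metis le_neq_trans less_trans p pq)
  ultimately have "d (Inl k) = 0"
    using less.prems by (intro least_exponent_coeff_eq_0[of ?J "Inl k" "case_sum p q" d]) auto
  then show ?case by (simp add: d_def)
qed

lemma shifted_exponentials_independent:
  fixes p :: "nat \<Rightarrow> real" and c \<mu> :: "nat \<Rightarrow> complex" and h :: real
  assumes p: "\<And>k l. k < l \<Longrightarrow> l < n \<Longrightarrow> p k < p l" and "h \<noteq> 0"
    and zero: "\<And>z. (\<Sum>k<n. c k * (exp (z * of_real (p k)) - \<mu> k * exp (z * of_real (p k + h)))) = 0"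
    and "k < n"
  shows "c k = 0"
proof (cases "h > 0")
  case True
  with p zero \<open>k < n\<close> show ?thesis
    by (intro shifted_exponentials_independent_aux[of n p "\<lambda>k. p k + h" c \<mu>]) auto
next
  case False
  \<comment> \<open>A negative shift becomes positive when all exponents are negated; reversing the
    indices makes them increasing again.\<close>
  define r where "r = (\<lambda>k. n - Suc k)"
  have "c (r (n - Suc k)) = 0"
  proof (rule shifted_exponentials_independent_aux[of n "\<lambda>k. - p (r k)" "\<lambda>k. - (p (r k) + h)" "\<lambda>k. c (r k)" "\<lambda>k. \<mu> (r k)"])
    show "- p (r k) < - p (r l)" if "k < l" "l < n" for k l
      using that p[of "r l" "r k"] by (auto simp: r_def)
    show "- p (r k) < - (p (r k) + h)" if "k < n" for k
      using False \<open>h \<noteq> 0\<close> by auto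
    show "(\<Sum>k<n. c (r k) * (exp (z * of_real (- p (r k))) - \<mu> (r k) * exp (z * of_real (- (p (r k) + h))))) = 0" for z
      using zero[of "- z"]
        sum.nat_diff_reindex[of "\<lambda>k. c k * (exp (z * of_real (- p k)) - \<mu> k * exp (z * of_real (- (p k + h))))" n]
      by (simp add: r_def algebra_simps)
    show "n - Suc k < n" using \<open>k < n\<close> by simp
  qed
  moreover have "r (n - Suc k) = k" using \<open>k < n\<close> by (simp add: r_def)
  ultimately show ?thesis by simp
qed

section \<open>Grids on intervals, and Hoelder continuity from squared increments\<close>

lemma finite_grid:
  fixes a b :: real
  assumes "a \<le> b" and "n > 0"
  obtains G where "finite G" "G \<subseteq> {a..b}" "card G \<le> n + 1"
    "\<And>x. x \<in> {a..b} \<Longrightarrow> \<exists>y\<in>G. \<bar>x - y\<bar> \<le> (b - a) / n"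
proof
  let ?G = "(\<lambda>i. a + (b - a) * real i / n) ` {..n}"
  show "finite ?G" by simp
  show "card ?G \<le> n + 1" using card_image_le[of "{..n}"] by force
  show "?G \<subseteq> {a..b}"
  proof safe
    fix i assume "i \<le> n"
    then have "(b - a) * (real i / n) \<le> (b - a) * 1"
      using assms by (intro mult_left_mono) auto
    moreover have "0 \<le> (b - a) * (real i / n)" using assms by simp
    ultimately show "a + (b - a) * real i / real n \<in> {a..b}" by simp
  qed
  fix x assume x: "x \<in> {a..b}"
  show "\<exists>y\<in>?G. \<bar>x - y\<bar> \<le> (b - a) / n"
  proof (cases "a = b")
    case False
    define z where "z = (x - a) / (b - a) * n"
    define i where "i = nat \<lfloor>z\<rfloor>"
    have "(x - a) / (b - a) \<le> 1" using x False by simp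
    then have z: "0 \<le> z" "z \<le> n" unfolding z_def using x
        mult_right_mono[of "(x - a) / (b - a)" 1 "real n"] by auto
    have i: "real i \<le> z" "z \<le> real i + 1" using z(1) by (auto simp: i_def)
    then have "i \<le> n" using z(2) by linarith
    have "x = a + (b - a) * z / n" using False assms(2) by (simp add: z_def)
    then have "x - (a + (b - a) * real i / n) = (b - a) * (z - real i) / n"
      by (simp add: algebra_simps diff_divide_distrib add_divide_distrib)
    moreover have "\<bar>(b - a) * (z - real i) / n\<bar> \<le> (b - a) / n"
      using i assms by (auto simp: abs_mult intro!: divide_right_mono mult_left_le)
    ultimately have "\<bar>x - (a + (b - a) * real i / n)\<bar> \<le> (b - a) / n" by simp
    then show ?thesis using \<open>i \<le> n\<close> by blast
  qed (use x in auto)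
qed

text \<open>By Cauchy-Schwarz, the squared increment over \<open>k - l\<close> mesh cells is at most
  \<open>k - l\<close> times the sum of the squared cell increments, which is linear in the
  distance. Continuity carries this from mesh points to all points. Infinitely many \<open>n\<close>
  suffice for the limit, which fits a bound on a limes inferior.\<close>

lemma holder_half_of_increments:
  fixes f :: "real \<Rightarrow> 'a::real_normed_vector"
  assumes cd: "c < d" and cont: "continuous_on {c..d} f"
    and freq: "\<exists>\<^sub>F n in sequentially.
      n * (\<Sum>j<n. (norm (f (c + (d - c) * real (Suc j) / n) - f (c + (d - c) * real j / n)))\<^sup>2) \<le> H * (d - c)"
    and uv: "u \<in> {c..d}" "v \<in> {c..d}"
  shows "(norm (f u - f v))\<^sup>2 \<le> H * \<bar>u - v\<bar>"
proof -
  \<comment> \<open>\<open>x n (i w n)\<close> is the last mesh point not beyond \<open>w\<close>;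
    it tends to \<open>w\<close>.\<close>
  define i where "i = (\<lambda>w n. nat \<lfloor>(w - c) / (d - c) * real n\<rfloor>)"
  define x where "x = (\<lambda>n j. c + (d - c) * real j / real n)"
  define P where "P = (\<lambda>n::nat. n * (\<Sum>j<n. (norm (f (x n (Suc j)) - f (x n j)))\<^sup>2) \<le> H * (d - c))"
  have P: "\<exists>\<^sub>F n in sequentially. P n"
    using freq by (simp add: P_def x_def)
  have i_le: "i w n \<le> n" if "w \<in> {c..d}" for w n
  proof -
    have "(w - c) / (d - c) \<le> 1" using that cd by simp
    then have "(w - c) / (d - c) * real n \<le> real n"
      using mult_right_mono[of "(w - c) / (d - c)" 1 "real n"] by simp
    then show ?thesis unfolding i_def by linarith
  qed
  have x_in: "x n j \<in> {c..d}" if "j \<le> n" for n j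
  proof -
    have "(d - c) * (real j / n) \<le> (d - c) * 1"
      using cd that by (intro mult_left_mono) (auto simp: divide_le_eq_1)
    then show ?thesis using cd by (simp add: x_def)
  qed
  have lim: "(\<lambda>n. x n (i w n)) \<longlonglongrightarrow> w" if w: "w \<in> {c..d}" for w
  proof (rule LIM_zero_cancel, rule Lim_null_comparison)
    show "\<forall>\<^sub>F n in sequentially. norm (x n (i w n) - w) \<le> (d - c) / real n"
      using eventually_gt_at_top[of 0]
    proof eventually_elim
      case (elim n)
      define z where "z = (w - c) / (d - c) * real n"
      have "0 \<le> z" using w cd by (simp add: z_def)
      moreover have "i w n = nat \<lfloor>z\<rfloor>" by (simp add: i_def z_def)
      ultimately have iz: "real (i w n) \<le> z" "z \<le> real (i w n) + 1" by auto
      have "w = c + (d - c) * z / n" using cd elim by (simp add: z_def)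
      then have "x n (i w n) - w = (d - c) * (real (i w n) - z) / n"
        by (simp add: x_def algebra_simps diff_divide_distrib add_divide_distrib)
      moreover have "\<bar>(d - c) * (real (i w n) - z) / n\<bar> \<le> (d - c) / n"
        using iz cd by (auto simp: abs_mult intro!: divide_right_mono mult_left_le)
      ultimately show ?case by simp
    qed
    show "(\<lambda>n. (d - c) / real n) \<longlonglongrightarrow> 0" by (rule lim_const_over_n)
  qed
  have flim: "(\<lambda>n. f (x n (i w n))) \<longlonglongrightarrow> f w" if w: "w \<in> {c..d}" for w
    using continuous_on_tendsto_compose[OF cont lim[OF w] w] x_in i_le w by simp
  have step: "(norm (f (x n k) - f (x n l)))\<^sup>2 \<le> H * (x n k - x n l)"
    if "P n" "l \<le> k" "k \<le> n" "n > 0" for n k l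
  proof -
    let ?D = "\<lambda>j. norm (f (x n (Suc j)) - f (x n j))"
    have "f (x n k) - f (x n l) = (\<Sum>j\<in>{l..<k}. f (x n (Suc j)) - f (x n j))"
      using sum_Suc_diff'[OF \<open>l \<le> k\<close>, of "\<lambda>j. f (x n j)"] by simp
    then have "(norm (f (x n k) - f (x n l)))\<^sup>2 \<le> (\<Sum>j\<in>{l..<k}. ?D j)\<^sup>2"
      by (simp add: norm_sum power_mono)
    also have "\<dots> \<le> (\<Sum>j\<in>{l..<k}. (?D j)\<^sup>2) * real (k - l)"
      using sum_squared_le_sum_of_squares[of ?D "{l..<k}"] by simp
    also have "\<dots> \<le> (\<Sum>j<n. (?D j)\<^sup>2) * real (k - l)"
      using that by (intro mult_right_mono sum_mono2) auto
    also have "\<dots> \<le> (H * (d - c) / n) * real (k - l)"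
      using that by (intro mult_right_mono) (auto simp: P_def pos_le_divide_eq mult.commute)
    also have "\<dots> = H * (x n k - x n l)"
      using that by (simp add: x_def of_nat_diff algebra_simps diff_divide_distrib)
    finally show ?thesis .
  qed
  have main: "(norm (f v - f u))\<^sup>2 \<le> H * (v - u)" if "u \<in> {c..d}" "v \<in> {c..d}" "u \<le> v" for u v
  proof (rule ccontr)
    \<comment> \<open>A strict violation in the limit would persist at the mesh points for all large
      \<open>n\<close>, while \<open>P n\<close> excludes it for infinitely many
      \<open>n\<close>.\<close>
    assume "\<not> ?thesis"
    then have neg: "H * (v - u) - (norm (f v - f u))\<^sup>2 < 0" by simp
    have "(\<lambda>n. H * (x n (i v n) - x n (i u n)) - (norm (f (x n (i v n)) - f (x n (i u n))))\<^sup>2)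
        \<longlonglongrightarrow> H * (v - u) - (norm (f v - f u))\<^sup>2"
      by (intro tendsto_intros lim flim that)
    then have "\<forall>\<^sub>F n in sequentially.
        H * (x n (i v n) - x n (i u n)) - (norm (f (x n (i v n)) - f (x n (i u n))))\<^sup>2 < 0"
      using neg by (rule order_tendstoD(2))
    then have "\<forall>\<^sub>F n in sequentially. \<not> P n"
      using eventually_gt_at_top[of 0]
    proof eventually_elim
      case (elim n)
      have "i u n \<le> i v n"
        unfolding i_def using that cd by (intro nat_mono floor_mono mult_right_mono divide_right_mono) auto
      with elim step[of n "i u n" "i v n"] i_le that show ?case by auto
    qed
    with P show False by (simp add: frequently_def)
  qed
  show ?thesis
    using main[of u v] main[of v u] uv by (cases "u \<le> v") (auto simp: norm_minus_commute)
qed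

section \<open>Gaussian random variables\<close>

context prob_space
begin

lemma real_gaussian_rv_square_integrable:
  assumes "real_gaussian_rv M X"
  shows "integrable M (\<lambda>x. (X x)\<^sup>2)" and "integrable M X"
proof -
  have X: "X \<in> borel_measurable M" using assms by (simp add: real_gaussian_rv_def)
  consider \<mu> \<sigma> where "\<sigma> > 0" "distributed M lborel X (normal_density \<mu> \<sigma>)"
    | c where "AE x in M. X x = c"
    using assms by (auto simp: real_gaussian_rv_def)
  then show sq: "integrable M (\<lambda>x. (X x)\<^sup>2)"
  proof cases
    case 1
    have "integrable M (\<lambda>x. (X x - \<mu>) ^ k)" for k
      using distributed_integrable[OF 1(2), of "\<lambda>x. (x - \<mu>) ^ k"]
        integrable_normal_moment[OF 1(1), of \<mu> k] by simp
    from this[of 2] this[of 1]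
    have "integrable M (\<lambda>x. (X x - \<mu>)\<^sup>2 + 2 * \<mu> * (X x - \<mu>) + \<mu>\<^sup>2)" by auto
    moreover have "(\<lambda>x. (X x - \<mu>)\<^sup>2 + 2 * \<mu> * (X x - \<mu>) + \<mu>\<^sup>2) = (\<lambda>x. (X x)\<^sup>2)"
      by (auto simp: power2_eq_square algebra_simps)
    ultimately show ?thesis by simp
  next
    case 2
    then have "integrable M (\<lambda>x. (X x)\<^sup>2) \<longleftrightarrow> integrable M (\<lambda>x. c\<^sup>2)"
      using X by (intro integrable_cong_AE) auto
    then show ?thesis by simp
  qed
  show "integrable M X"
    by (rule square_integrable_imp_integrable[OF X sq])
qed

text \<open>A nondegenerate variable is rescaled to a standard normal one. A constant one is zero by
  the mean condition, and both sides are 1. The second moment therefore determines the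
  characteristic function in either case.\<close>

lemma char_centered_gaussian:
  assumes G: "real_gaussian_rv M X" and mean: "expectation X = 0"
  shows "expectation (\<lambda>x. exp (\<i> * of_real (X x))) = of_real (exp (- expectation (\<lambda>x. (X x)\<^sup>2) / 2))"
proof -
  have X: "X \<in> borel_measurable M" using assms by (simp add: real_gaussian_rv_def)
  consider \<mu> \<sigma> where "\<sigma> > 0" "distributed M lborel X (normal_density \<mu> \<sigma>)"
    | c where "AE x in M. X x = c"
    using assms by (auto simp: real_gaussian_rv_def)
  then show ?thesis
  proof cases
    case 1
    have [simp]: "\<mu> = 0" using normal_distributed_expectation[OF 1] mean by simp
    have var: "expectation (\<lambda>x. (X x)\<^sup>2) = \<sigma>\<^sup>2"
      using normal_distributed_variance[OF 1] mean by simp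
    define Y where "Y = (\<lambda>x. X x / \<sigma>)"
    have "distributed M lborel Y std_normal_density"
      using 1 normal_standard_normal_convert[OF 1(1), of X \<mu>] by (simp add: Y_def)
    then have dY: "distr M borel Y = std_normal_distribution"
      using distributed_distr_eq_density[of M lborel Y] by (simp cong: distr_cong)
    have "expectation (\<lambda>x. exp (\<i> * of_real (X x))) = expectation (\<lambda>x. exp (\<i> * of_real (\<sigma> * Y x)))"
      using 1(1) by (simp add: Y_def)
    also have "\<dots> = char (distr M borel Y) \<sigma>"
      unfolding char_def using X by (subst integral_distr) (auto simp: Y_def)
    also have "\<dots> = of_real (exp (- \<sigma>\<^sup>2 / 2))"
      by (simp add: dY char_std_normal_distribution)
    finally show ?thesis using var by simp
  next
    case 2
    have "expectation X = expectation (\<lambda>x. c)"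
      using 2 X by (intro integral_cong_AE) auto
    then have [simp]: "c = 0" using mean by (simp add: prob_space)
    have "expectation (\<lambda>x. (X x)\<^sup>2) = expectation (\<lambda>x. 0)"
      using 2 X by (intro integral_cong_AE) auto
    moreover have "expectation (\<lambda>x. exp (\<i> * of_real (X x))) = expectation (\<lambda>x. 1)"
      using 2 X by (intro integral_cong_AE) auto
    ultimately show ?thesis by (simp add: prob_space)
  qed
qed

end

text \<open>Completing the exponents turns the integrand into \<open>\<sigma>\<close> times the
  centred normal density of variance \<open>1 / (1 + a)\<close>.\<close>

lemma std_normal_integral_exp_neg_square:
  "(\<integral>t. exp (- (a * t\<^sup>2) / 2) \<partial>std_normal_distribution) = 1 / sqrt (1 + a)"
  "integrable std_normal_distribution (\<lambda>t. exp (- (a * t\<^sup>2) / 2))" if "a \<ge> 0" for a :: real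
proof -
  define \<sigma> where "\<sigma> = 1 / sqrt (1 + a)"
  have \<sigma>: "\<sigma> > 0" "\<sigma>\<^sup>2 = 1 / (1 + a)" using that by (auto simp: \<sigma>_def power_divide)
  have eq: "std_normal_density t * exp (- (a * t\<^sup>2) / 2) = \<sigma> * normal_density 0 \<sigma> t" for t
  proof -
    have "- t\<^sup>2 / 2 + - (a * t\<^sup>2) / 2 = - (t - 0)\<^sup>2 / (2 * \<sigma>\<^sup>2)"
      using that by (simp add: \<sigma> field_simps)
    then have "exp (- t\<^sup>2 / 2) * exp (- (a * t\<^sup>2) / 2) = exp (- (t - 0)\<^sup>2 / (2 * \<sigma>\<^sup>2))"
      by (simp only: exp_add[symmetric])
    moreover have "sqrt (2 * pi * \<sigma>\<^sup>2) = sqrt (2 * pi) * \<sigma>"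
      using \<sigma>(1) by (simp add: real_sqrt_mult)
    ultimately show ?thesis
      using \<sigma>(1) by (simp add: normal_density_def)
  qed
  have "(\<integral>t. exp (- (a * t\<^sup>2) / 2) \<partial>std_normal_distribution) =
      (\<integral>t. std_normal_density t * exp (- (a * t\<^sup>2) / 2) \<partial>lborel)"
    by (subst integral_density) auto
  also have "\<dots> = \<sigma>"
    unfolding eq using \<sigma> by (simp add: integral_normal_density)
  finally show "(\<integral>t. exp (- (a * t\<^sup>2) / 2) \<partial>std_normal_distribution) = 1 / sqrt (1 + a)"
    by (simp add: \<sigma>_def)
  have "integrable lborel (\<lambda>t. std_normal_density t * exp (- (a * t\<^sup>2) / 2))"
    unfolding eq using \<sigma> by (simp add: integrable_normal_density)
  then show "integrable std_normal_distribution (\<lambda>t. exp (- (a * t\<^sup>2) / 2))"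
    by (subst integrable_density) auto
qed

text \<open>The idea is to write \<open>exp (- \<bar>Z\<bar>\<^sup>2 / (2 \<epsilon>\<^sup>2))\<close> as the characteristic function of a standard normal vector
  \<open>\<zeta>\<close> at \<open>Z / \<epsilon>\<close> and to take the expectation over \<open>Z\<close> first, which needs no joint density of \<open>Z\<close>.\<close>

lemma (in prob_space) gaussian_small_ball:
  fixes Z :: "'i \<Rightarrow> 'a \<Rightarrow> real" and V :: "('i \<Rightarrow> real) \<Rightarrow> real"
  assumes "finite I" and Z: "\<And>i. i \<in> I \<Longrightarrow> Z i \<in> borel_measurable M"
    and char: "\<And>\<zeta>. expectation (\<lambda>x. exp (\<i> * of_real (\<Sum>i\<in>I. \<zeta> i * Z i x))) = of_real (exp (- V \<zeta> / 2))"
    and V: "\<And>\<zeta>. \<kappa> * (\<Sum>i\<in>I. (\<zeta> i)\<^sup>2) \<le> V \<zeta>"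
    and "\<kappa> > 0" "\<epsilon> > 0"
  shows "prob {x \<in> space M. \<forall>i\<in>I. \<bar>Z i x\<bar> \<le> \<epsilon>} \<le> (exp (1/2) * \<epsilon> / sqrt \<kappa>) ^ card I"
proof -
  define P where "P = Pi\<^sub>M I (\<lambda>_. std_normal_distribution)"
  interpret N: prob_space std_normal_distribution
    by (rule prob_space_normal_density) simp
  interpret PS: product_sigma_finite "\<lambda>_::'i. std_normal_distribution"
    by standard
  interpret P: prob_space P
    unfolding P_def by (intro prob_space_PiM N.prob_space_axioms)
  interpret MP: pair_sigma_finite M P ..
  interpret MPP: pair_prob_space M P ..
  \<comment> \<open>\<open>h\<close> has modulus 1 on a product of probability spaces, so Fubini
    applies. Integrating over \<open>\<zeta>\<close> gives the Gaussian weight \<open>g\<close>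
    below; integrating over \<open>x\<close> gives the characteristic function of
    \<open>Z\<close>.\<close>
  define h where "h = (\<lambda>x \<zeta>. exp (\<i> * of_real (\<Sum>i\<in>I. \<zeta> i / \<epsilon> * Z i x)))"
  have [measurable]: "(\<lambda>z. snd z i) \<in> borel_measurable (M \<Otimes>\<^sub>M P)" if "i \<in> I" for i
  proof -
    have "(\<lambda>\<zeta>. \<zeta> i) \<in> measurable P std_normal_distribution"
      unfolding P_def using that by (rule measurable_component_singleton)
    then have "(\<lambda>\<zeta>. \<zeta> i) \<in> borel_measurable P" by simp
    then show ?thesis by (rule measurable_compose[OF measurable_snd])
  qed
  have [measurable]: "(\<lambda>z. Z i (fst z)) \<in> borel_measurable (M \<Otimes>\<^sub>M P)" if "i \<in> I" for i
    using Z[OF that] by (rule measurable_compose[OF measurable_fst])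
  have "(\<lambda>z. \<Sum>i\<in>I. snd z i / \<epsilon> * Z i (fst z)) \<in> borel_measurable (M \<Otimes>\<^sub>M P)"
    by (intro borel_measurable_sum borel_measurable_times borel_measurable_divide) (simp_all add: measurable)
  then have hm: "case_prod h \<in> borel_measurable (M \<Otimes>\<^sub>M P)"
    unfolding h_def split_beta by measurable
  have hi: "integrable (M \<Otimes>\<^sub>M P) (case_prod h)"
    using hm by (rule MPP.P.integrable_const_bound[where B=1, rotated]) (auto simp: h_def norm_exp_i_times)
  have inner: "(\<integral>\<zeta>. h x \<zeta> \<partial>P) = of_real (\<Prod>i\<in>I. exp (- (Z i x / \<epsilon>)\<^sup>2 / 2))" for x
  proof -
    have "(\<integral>\<zeta>. h x \<zeta> \<partial>P) = (\<integral>\<zeta>. (\<Prod>i\<in>I. exp (\<i> * of_real (Z i x / \<epsilon> * \<zeta> i))) \<partial>P)"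
      using \<open>finite I\<close> by (simp add: h_def exp_sum[symmetric] sum_distrib_left mult.commute)
    also have "\<dots> = (\<Prod>i\<in>I. \<integral>t. exp (\<i> * of_real (Z i x / \<epsilon> * t)) \<partial>std_normal_distribution)"
      unfolding P_def using \<open>finite I\<close>
      by (intro PS.product_integral_prod N.integrable_const_bound[where B=1]) (auto simp: norm_exp_i_times)
    also have "\<dots> = (\<Prod>i\<in>I. char std_normal_distribution (Z i x / \<epsilon>))"
      by (simp add: char_def)
    finally show ?thesis by (simp add: char_std_normal_distribution)
  qed
  have outer: "expectation (\<lambda>x. h x \<zeta>) = of_real (exp (- V (\<lambda>i. \<zeta> i / \<epsilon>) / 2))" for \<zeta>
    unfolding h_def by (rule char)
  define E where "E = {x \<in> space M. \<forall>i\<in>I. \<bar>Z i x\<bar> \<le> \<epsilon>}"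
  have E: "E \<in> sets M"
    unfolding E_def using \<open>finite I\<close> Z by measurable
  define g where "g = (\<lambda>x. \<Prod>i\<in>I. exp (- (Z i x / \<epsilon>)\<^sup>2 / 2))"
  have g_int: "integrable M g"
  proof (rule integrable_const_bound[where B=1])
    show "AE x in M. norm (g x) \<le> 1"
      by (auto simp: g_def abs_prod intro!: prod_le_1)
    show "g \<in> borel_measurable M" unfolding g_def using Z by measurable
  qed
  \<comment> \<open>A Markov-type bound: on \<open>E\<close> each factor of \<open>g\<close> is at
    least \<open>exp (- 1/2)\<close>.\<close>
  have "exp (- 1/2) ^ card I * indicator E x \<le> g x" for x
  proof (cases "x \<in> E")
    case True
    have "exp (- 1/2) \<le> exp (- (Z i x / \<epsilon>)\<^sup>2 / 2)" if "i \<in> I" for i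
    proof -
      have "\<bar>Z i x / \<epsilon>\<bar> \<le> 1" using True that \<open>\<epsilon> > 0\<close> by (simp add: E_def)
      then have "(Z i x / \<epsilon>)\<^sup>2 \<le> 1" by (simp add: abs_square_le_1)
      then show ?thesis by simp
    qed
    then have "(\<Prod>i\<in>I. exp (- 1/2)) \<le> g x"
      unfolding g_def by (intro prod_mono) auto
    then show ?thesis using True by simp
  next
    case False
    then show ?thesis by (simp add: g_def prod_nonneg)
  qed
  then have "expectation (\<lambda>x. exp (- 1/2) ^ card I * indicator E x) \<le> expectation g"
    using E g_int by (intro integral_mono) (auto simp: emeasure_eq_measure)
  then have 1: "exp (- 1/2) ^ card I * prob E \<le> expectation g"
    using E by simp
  have "of_real (expectation g) = expectation (\<lambda>x. complex_of_real (g x))" by simp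
  also have "\<dots> = expectation (\<lambda>x. \<integral>\<zeta>. h x \<zeta> \<partial>P)" by (simp add: inner g_def)
  also have "\<dots> = (\<integral>\<zeta>. expectation (\<lambda>x. h x \<zeta>) \<partial>P)"
    using MP.Fubini_integral[OF hi] by simp
  also have "\<dots> = of_real (\<integral>\<zeta>. exp (- V (\<lambda>i. \<zeta> i / \<epsilon>) / 2) \<partial>P)"
    by (simp add: outer)
  finally have 2: "expectation g = (\<integral>\<zeta>. exp (- V (\<lambda>i. \<zeta> i / \<epsilon>) / 2) \<partial>P)"
    using of_real_eq_iff by blast
  have Vint: "integrable P (\<lambda>\<zeta>. exp (- V (\<lambda>i. \<zeta> i / \<epsilon>) / 2))"
    using MP.integrable_snd[OF hi] integrable_Re[of P] by (fastforce simp: outer)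
  \<comment> \<open>The lower bound on \<open>V\<close> decouples the coordinates, and the remaining
    integral is a product of one-dimensional ones, each at most
    \<open>\<epsilon> / sqrt \<kappa>\<close>.\<close>
  have le: "exp (- V (\<lambda>i. \<zeta> i / \<epsilon>) / 2) \<le> (\<Prod>i\<in>I. exp (- (\<kappa> / \<epsilon>\<^sup>2 * (\<zeta> i)\<^sup>2) / 2))" for \<zeta>
  proof -
    have "\<kappa> * (\<Sum>i\<in>I. (\<zeta> i / \<epsilon>)\<^sup>2) = (\<Sum>i\<in>I. \<kappa> / \<epsilon>\<^sup>2 * (\<zeta> i)\<^sup>2)"
      by (simp add: sum_distrib_left power_divide)
    then have "- V (\<lambda>i. \<zeta> i / \<epsilon>) / 2 \<le> (\<Sum>i\<in>I. - (\<kappa> / \<epsilon>\<^sup>2 * (\<zeta> i)\<^sup>2) / 2)"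
      using V[of "\<lambda>i. \<zeta> i / \<epsilon>"] by (simp add: sum_divide_distrib[symmetric] sum_negf)
    then show ?thesis
      using \<open>finite I\<close> by (simp add: exp_sum[symmetric])
  qed
  have nn: "\<kappa> / \<epsilon>\<^sup>2 \<ge> 0" using \<open>\<kappa> > 0\<close> by simp
  have "(\<integral>\<zeta>. exp (- V (\<lambda>i. \<zeta> i / \<epsilon>) / 2) \<partial>P) \<le> (\<integral>\<zeta>. (\<Prod>i\<in>I. exp (- (\<kappa> / \<epsilon>\<^sup>2 * (\<zeta> i)\<^sup>2) / 2)) \<partial>P)"
    unfolding P_def using \<open>finite I\<close> Vint[unfolded P_def] le
    by (intro integral_mono PS.product_integrable_prod std_normal_integral_exp_neg_square(2)[OF nn]) auto
  also have "\<dots> = (\<Prod>i\<in>I. 1 / sqrt (1 + \<kappa> / \<epsilon>\<^sup>2))"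
    unfolding P_def using \<open>finite I\<close> std_normal_integral_exp_neg_square[OF nn]
    by (subst PS.product_integral_prod[OF \<open>finite I\<close>]) auto
  also have "\<dots> \<le> (\<Prod>i\<in>I. \<epsilon> / sqrt \<kappa>)"
  proof (intro prod_mono conjI)
    have "sqrt (\<kappa> / \<epsilon>\<^sup>2) \<le> sqrt (1 + \<kappa> / \<epsilon>\<^sup>2)" by simp
    then have "1 / sqrt (1 + \<kappa> / \<epsilon>\<^sup>2) \<le> 1 / sqrt (\<kappa> / \<epsilon>\<^sup>2)"
      using \<open>\<kappa> > 0\<close> \<open>\<epsilon> > 0\<close> by (intro divide_left_mono) (auto intro!: mult_pos_pos add_pos_pos)
    also have "\<dots> = \<epsilon> / sqrt \<kappa>" using \<open>\<epsilon> > 0\<close> by (simp add: real_sqrt_divide)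
    finally show "1 / sqrt (1 + \<kappa> / \<epsilon>\<^sup>2) \<le> \<epsilon> / sqrt \<kappa>" .
  qed (use nn in auto)
  finally have "exp (- 1/2) ^ card I * prob E \<le> (\<epsilon> / sqrt \<kappa>) ^ card I"
    using 1 2 by simp
  then have "exp (1/2) ^ card I * (exp (- 1/2) ^ card I * prob E) \<le> exp (1/2) ^ card I * (\<epsilon> / sqrt \<kappa>) ^ card I"
    by (intro mult_left_mono) auto
  moreover have "exp (1/2) ^ card I * exp (- 1/2) ^ card I = (1::real)"
    by (simp add: power_mult_distrib[symmetric] exp_add[symmetric])
  ultimately show ?thesis
    by (simp add: E_def mult.assoc[symmetric] power_mult_distrib[symmetric])
qed

text \<open>The exceptional set may fail to be an event when \<open>P\<close> quantifies over
  uncountably many parameters. The intersection of the covers is a null event that contains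
  it.\<close>

lemma (in prob_space) AE_of_small_covers:
  assumes "\<And>n::nat. n > 0 \<Longrightarrow> \<exists>A\<in>events. {x \<in> space M. \<not> P x} \<subseteq> A \<and> prob A \<le> K / real n"
  shows "AE x in M. P x"
proof -
  have "\<forall>n. \<exists>A. A \<in> events \<and> {x \<in> space M. \<not> P x} \<subseteq> A \<and> prob A \<le> K / real (Suc n)"
    using assms by (meson zero_less_Suc)
  then obtain A where A: "\<And>n. A n \<in> events" "\<And>n. {x \<in> space M. \<not> P x} \<subseteq> A n"
    "\<And>n. prob (A n) \<le> K / real (Suc n)"
    by metis
  define N where "N = (\<Inter>n. A n)"
  have N: "N \<in> events" unfolding N_def using A(1) by auto
  have "prob N \<le> K / real (Suc n)" for n
    using finite_measure_mono[OF _ A(1)[of n], of N] A(3)[of n] by (force simp: N_def)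
  moreover have "(\<lambda>n. K / real (Suc n)) \<longlonglongrightarrow> 0"
    by (rule LIMSEQ_Suc[OF lim_const_over_n])
  ultimately have "prob N \<le> 0" by (intro LIMSEQ_le_const) auto
  then have "N \<in> null_sets M" using N by (auto simp: emeasure_eq_measure measure_le_0_iff)
  then show ?thesis
    using A(2) by (elim AE_I') (auto simp: N_def)
qed

section \<open>The lowpass process\<close>

lemma spectral_cov_lowpass:
  "spectral_cov (lowpass_density B) d = integral {-B/2..B/2} (\<lambda>f. cis (f * d))"
proof -
  have cont: "continuous_on {-B/2..B/2} (\<lambda>f. cis (f * d))" by (intro continuous_intros)
  have "spectral_cov (lowpass_density B) d = (LINT f:{-B/2..B/2}|lborel. cis (f * d))"
    unfolding spectral_cov_def set_lebesgue_integral_def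
    by (intro Bochner_Integration.integral_cong) (auto simp: lowpass_density_def cis_conv_exp)
  also have "\<dots> = integral {-B/2..B/2} (\<lambda>f. cis (f * d))"
    using borel_integrable_compact[OF _ cont]
    by (intro set_borel_integral_eq_integral) (auto simp: set_integrable_def)
  finally show ?thesis .
qed

lemma norm_cis_diff_le: "norm (cis x - cis y) \<le> \<bar>x - y\<bar>"
proof -
  have "cis x - cis y = cis y * (cis (x - y) - 1)"
    by (simp add: right_diff_distrib cis_mult)
  then have "norm (cis x - cis y) = norm (exp (\<i> * of_real (x - y)) - 1)"
    by (simp add: norm_mult cis_conv_exp)
  also have "\<dots> = 2 * \<bar>sin ((x - y) / 2)\<bar>" by (rule dist_exp_i_1)
  also have "\<dots> \<le> \<bar>x - y\<bar>" using abs_sin_x_le_abs_x[of "(x - y) / 2"] by simp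
  finally show ?thesis .
qed

text \<open>The exceptional event ranges over uncountably many shifts, which finite-dimensional
  distributions alone do not control; path continuity links them.\<close>

locale lowpass_process = prob_space M for M :: "'w measure" +
  fixes s :: "real \<Rightarrow> 'w \<Rightarrow> complex" and B :: real
  assumes gauss: "complex_gaussian_process M s"
    and mean: "\<And>u. expectation (s u) = 0"
    and cov: "\<And>u u'. expectation (\<lambda>x. s u x * cnj (s u' x)) = spectral_cov (lowpass_density B) (u - u')"
    and circ: "\<And>u u'. expectation (\<lambda>x. s u x * s u' x) = 0"
    and cont: "AE x in M. continuous_on UNIV (\<lambda>u. s u x)"
    and B_pos: "B > 0"
begin

lemma measurable_s [measurable]: "s u \<in> borel_measurable M"
  using gauss by (simp add: complex_gaussian_process_def)

lemma real_gaussian_rv_combination: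
  assumes "finite J"
  shows "real_gaussian_rv M (\<lambda>x. Re (\<Sum>j\<in>J. d j * s (u j) x))"
proof -
  obtain js where js: "distinct js" "set js = J"
    using finite_distinct_list[OF assms] by blast
  have "real_gaussian_rv M (\<lambda>x. Re (\<Sum>k<length (map u js). map d js ! k * s (map u js ! k) x))"
    using gauss unfolding complex_gaussian_process_def
    by (elim conjE allE[of _ "map u js"] allE[of _ "map d js"]) simp
  moreover have "(\<Sum>k<length (map u js). map d js ! k * s (map u js ! k) x) = (\<Sum>j\<in>J. d j * s (u j) x)" for x
    using sum.reindex_bij_betw[OF bij_betw_nth[OF js(1) refl js(2)[symmetric]], of "\<lambda>j. d j * s (u j) x"]
    by simp
  ultimately show ?thesis by (simp only:)
qed

lemma integrable_Re_Im:
  "integrable M (\<lambda>x. (Re (s u x))\<^sup>2)" "integrable M (\<lambda>x. (Im (s u x))\<^sup>2)"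
  "integrable M (\<lambda>x. Re (s u x))" "integrable M (\<lambda>x. Im (s u x))"
  using real_gaussian_rv_square_integrable[OF real_gaussian_rv_combination[of "{()}" "\<lambda>_. 1" "\<lambda>_. u"]]
    real_gaussian_rv_square_integrable[OF real_gaussian_rv_combination[of "{()}" "\<lambda>_. - \<i>" "\<lambda>_. u"]]
  by simp_all

lemma integrable_s: "integrable M (s u)"
proof -
  have "integrable M (\<lambda>x. of_real (Re (s u x)) + \<i> * of_real (Im (s u x)))"
    using integrable_Re_Im[of u] by (intro Bochner_Integration.integrable_add integrable_mult_right integrable_of_real)
  then show ?thesis by (simp add: complex_eq[symmetric])
qed

lemma integrable_norm_s_square: "integrable M (\<lambda>x. (norm (s u x))\<^sup>2)"
  using integrable_Re_Im[of u] by (simp add: cmod_power2)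

lemma integrable_products:
  "integrable M (\<lambda>x. s u x * cnj (s v x))" "integrable M (\<lambda>x. s u x * s v x)"
proof -
  have i: "integrable M (\<lambda>x. (norm (s u x))\<^sup>2 + (norm (s v x))\<^sup>2)"
    using integrable_norm_s_square by simp
  have le: "norm (s u x) * norm (s v x) \<le> (norm (s u x))\<^sup>2 + (norm (s v x))\<^sup>2" for x
    using sum_squares_bound[of "norm (s u x)" "norm (s v x)"]
      mult_nonneg_nonneg[OF norm_ge_zero[of "s u x"] norm_ge_zero[of "s v x"]] by linarith
  have [measurable]: "cnj \<in> borel_measurable borel"
    by (intro borel_measurable_continuous_onI continuous_intros)
  show "integrable M (\<lambda>x. s u x * cnj (s v x))"
  proof (rule Bochner_Integration.integrable_bound[OF i])
    show "AE x in M. norm (s u x * cnj (s v x)) \<le> norm ((norm (s u x))\<^sup>2 + (norm (s v x))\<^sup>2)"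
      using le by (simp add: norm_mult)
  qed measurable
  show "integrable M (\<lambda>x. s u x * s v x)"
  proof (rule Bochner_Integration.integrable_bound[OF i])
    show "AE x in M. norm (s u x * s v x) \<le> norm ((norm (s u x))\<^sup>2 + (norm (s v x))\<^sup>2)"
      using le by (simp add: norm_mult)
  qed measurable
qed

text \<open>The squared norm, in the Hilbert space of square-integrable functions on the band, of
  the exponential sum that corresponds to a linear combination of samples.\<close>

definition spectral_energy :: "'j set \<Rightarrow> ('j \<Rightarrow> complex) \<Rightarrow> ('j \<Rightarrow> real) \<Rightarrow> real" where
  "spectral_energy J d u = integral {-B/2..B/2} (\<lambda>f. (norm (\<Sum>j\<in>J. d j * cis (f * u j)))\<^sup>2)"

text \<open>The spectral isometry. The expansion \<open>eq\<close> serves twice: with samples it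
  reduces the second moment to covariances, and with exponentials it reassembles their spectral
  integrals into one square.\<close>

lemma second_moment_combination:
  assumes "finite J"
  shows "integrable M (\<lambda>x. (norm (\<Sum>j\<in>J. d j * s (u j) x))\<^sup>2)"
    and "expectation (\<lambda>x. (norm (\<Sum>j\<in>J. d j * s (u j) x))\<^sup>2) = spectral_energy J d u"
proof -
  have eq: "of_real ((norm (\<Sum>j\<in>J. d j * g j))\<^sup>2) = (\<Sum>j\<in>J. \<Sum>k\<in>J. d j * cnj (d k) * (g j * cnj (g k)))"
    for g :: "_ \<Rightarrow> complex"
    unfolding complex_norm_square by (simp add: sum_product mult_ac)
  have i: "integrable M (\<lambda>x. complex_of_real ((norm (\<Sum>j\<in>J. d j * s (u j) x))\<^sup>2))"
    unfolding eq by (intro Bochner_Integration.integrable_sum integrable_mult_right integrable_products)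
  then have "integrable M (\<lambda>x. Re (complex_of_real ((norm (\<Sum>j\<in>J. d j * s (u j) x))\<^sup>2)))"
    by (rule integrable_Re)
  then show "integrable M (\<lambda>x. (norm (\<Sum>j\<in>J. d j * s (u j) x))\<^sup>2)" by simp
  have int: "(\<lambda>f. d j * cnj (d k) * (cis (f * u j) * cnj (cis (f * u k)))) integrable_on {-B/2..B/2}" for j k
    by (intro integrable_continuous_interval continuous_intros)
  have "of_real (expectation (\<lambda>x. (norm (\<Sum>j\<in>J. d j * s (u j) x))\<^sup>2))
      = expectation (\<lambda>x. complex_of_real ((norm (\<Sum>j\<in>J. d j * s (u j) x))\<^sup>2))"
    by (rule integral_complex_of_real[symmetric])
  also have "\<dots> = (\<Sum>j\<in>J. \<Sum>k\<in>J. d j * cnj (d k) * expectation (\<lambda>x. s (u j) x * cnj (s (u k) x)))"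
    unfolding eq by (simp add: Bochner_Integration.integral_sum integrable_products)
  also have "\<dots> = (\<Sum>j\<in>J. \<Sum>k\<in>J. integral {-B/2..B/2} (\<lambda>f. d j * cnj (d k) * (cis (f * u j) * cnj (cis (f * u k)))))"
    by (simp add: cov spectral_cov_lowpass cis_cnj cis_mult right_diff_distrib)
  also have "\<dots> = integral {-B/2..B/2} (\<lambda>f. \<Sum>j\<in>J. \<Sum>k\<in>J. d j * cnj (d k) * (cis (f * u j) * cnj (cis (f * u k))))"
    using assms int by (simp add: integral_sum integrable_sum)
  also have "\<dots> = integral {-B/2..B/2} (\<lambda>f. complex_of_real ((norm (\<Sum>j\<in>J. d j * cis (f * u j)))\<^sup>2))"
    unfolding eq ..
  also have "\<dots> = of_real (spectral_energy J d u)"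
    unfolding spectral_energy_def
    by (intro integral_unique has_integral_of_real integrable_integral integrable_continuous_interval continuous_intros)
  finally show "expectation (\<lambda>x. (norm (\<Sum>j\<in>J. d j * s (u j) x))\<^sup>2) = spectral_energy J d u"
    using of_real_eq_iff by blast
qed

text \<open>Circular symmetry makes the expectation of the square of the complex combination vanish.
  Its real part therefore carries exactly half of the second moment, which is the inner division by
  2.\<close>

lemma char_combination:
  assumes "finite J"
  shows "expectation (\<lambda>x. exp (\<i> * of_real (Re (\<Sum>j\<in>J. d j * s (u j) x)))) =
    of_real (exp (- (spectral_energy J d u / 2) / 2))"
proof -
  let ?Z = "\<lambda>x. \<Sum>j\<in>J. d j * s (u j) x"
  have "expectation (\<lambda>x. Re (?Z x)) = Re (expectation ?Z)"
    by (intro integral_Re Bochner_Integration.integrable_sum integrable_mult_right integrable_s)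
  also have "\<dots> = 0"
    by (simp add: Bochner_Integration.integral_sum integrable_s mean)
  finally have 0: "expectation (\<lambda>x. Re (?Z x)) = 0" .
  have sq: "(?Z x)\<^sup>2 = (\<Sum>j\<in>J. \<Sum>k\<in>J. d j * d k * (s (u j) x * s (u k) x))" for x
    by (simp add: power2_eq_square sum_product mult_ac)
  have sqi: "integrable M (\<lambda>x. (?Z x)\<^sup>2)"
    unfolding sq by (intro Bochner_Integration.integrable_sum integrable_mult_right integrable_products)
  have "expectation (\<lambda>x. (?Z x)\<^sup>2) = 0"
    unfolding sq by (simp add: Bochner_Integration.integral_sum integrable_products circ)
  then have Re0: "expectation (\<lambda>x. Re ((?Z x)\<^sup>2)) = 0"
    using integral_Re[OF sqi] by simp
  have "(Re z)\<^sup>2 = ((norm z)\<^sup>2 + Re (z\<^sup>2)) / 2" for z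
    by (simp add: cmod_power2 Re_power2)
  then have "expectation (\<lambda>x. (Re (?Z x))\<^sup>2) = expectation (\<lambda>x. ((norm (?Z x))\<^sup>2 + Re ((?Z x)\<^sup>2)) / 2)"
    by presburger
  also have "\<dots> = spectral_energy J d u / 2"
    using second_moment_combination[OF assms] integrable_Re[OF sqi] Re0 by simp
  finally show ?thesis
    using char_centered_gaussian[OF real_gaussian_rv_combination[OF assms] 0] by simp
qed

text \<open>On the band the two exponentials differ by at most
  \<open>B / 2 * \<bar>u - v\<bar>\<close>; squaring and multiplying by the band length
  \<open>B\<close> gives the constant.\<close>

lemma increment_second_moment:
  "integrable M (\<lambda>x. (norm (s u x - s v x))\<^sup>2)"
  "expectation (\<lambda>x. (norm (s u x - s v x))\<^sup>2) \<le> B ^ 3 / 4 * (u - v)\<^sup>2"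
proof -
  define d :: "bool \<Rightarrow> complex" where "d = (\<lambda>b. if b then 1 else -1)"
  define w where "w = (\<lambda>b. if b then u else v)"
  have eq: "(\<Sum>b\<in>UNIV. d b * s (w b) x) = s u x - s v x" for x
    by (simp add: UNIV_bool d_def w_def)
  show "integrable M (\<lambda>x. (norm (s u x - s v x))\<^sup>2)"
    using second_moment_combination(1)[of UNIV d w] by (simp add: eq)
  have "expectation (\<lambda>x. (norm (s u x - s v x))\<^sup>2) = spectral_energy UNIV d w"
    using second_moment_combination(2)[of UNIV d w] by (simp add: eq)
  also have "\<dots> = integral {-B/2..B/2} (\<lambda>f. (norm (cis (f * u) - cis (f * v)))\<^sup>2)"
    by (simp add: spectral_energy_def UNIV_bool d_def w_def)
  also have "\<dots> \<le> integral {-B/2..B/2} (\<lambda>f. (B / 2 * \<bar>u - v\<bar>)\<^sup>2)"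
  proof (intro integral_le integrable_continuous_interval continuous_intros power_mono)
    fix f assume "f \<in> {-B/2..B/2}"
    then have "\<bar>f * (u - v)\<bar> \<le> B / 2 * \<bar>u - v\<bar>"
      unfolding abs_mult by (intro mult_right_mono) auto
    then show "norm (cis (f * u) - cis (f * v)) \<le> B / 2 * \<bar>u - v\<bar>"
      using norm_cis_diff_le[of "f * u" "f * v"] by (simp add: right_diff_distrib)
  qed auto
  also have "\<dots> = B ^ 3 / 4 * (u - v)\<^sup>2"
    using B_pos by (simp add: power_mult_distrib power_divide power2_eq_square power3_eq_cube)
  finally show "expectation (\<lambda>x. (norm (s u x - s v x))\<^sup>2) \<le> B ^ 3 / 4 * (u - v)\<^sup>2" .
qed

text \<open>\<open>Q n\<close> is \<open>n\<close> times the sum of squared increments over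
  \<open>n\<close> equal cells. Each cell contributes order \<open>1/n\<^sup>2\<close> in
  expectation, so the expectations stay bounded, and by Fatou's lemma the limes inferior of
  \<open>Q n\<close> is finite almost surely.\<close>

lemma AE_holder_half:
  assumes "c < d"
  shows "AE x in M. \<exists>H. \<forall>u\<in>{c..d}. \<forall>v\<in>{c..d}. (norm (s u x - s v x))\<^sup>2 \<le> H * \<bar>u - v\<bar>"
proof -
  define Q where "Q = (\<lambda>n x. real n *
    (\<Sum>j<n. (norm (s (c + (d - c) * real (Suc j) / n) x - s (c + (d - c) * real j / n) x))\<^sup>2))"
  define C where "C = B ^ 3 / 4 * (d - c)\<^sup>2"
  have [measurable]: "Q n \<in> borel_measurable M" for n
    unfolding Q_def by measurable
  have Q_nn: "0 \<le> Q n x" for n x by (simp add: Q_def sum_nonneg)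
  have Qi: "integrable M (Q n)" for n
    unfolding Q_def by (intro integrable_mult_right Bochner_Integration.integrable_sum increment_second_moment)
  have "C \<ge> 0" using B_pos by (simp add: C_def)
  have EQ: "expectation (Q n) \<le> C" for n
  proof (cases "n = 0")
    case False
    have "expectation (Q n) = real n *
      (\<Sum>j<n. expectation (\<lambda>x. (norm (s (c + (d - c) * real (Suc j) / n) x - s (c + (d - c) * real j / n) x))\<^sup>2))"
      unfolding Q_def by (simp only: integral_mult_right_zero Bochner_Integration.integral_sum increment_second_moment)
    also have "\<dots> \<le> real n * (\<Sum>j<n. B ^ 3 / 4 * ((d - c) / n)\<^sup>2)"
    proof (intro mult_left_mono sum_mono)
      fix j
      have "c + (d - c) * real (Suc j) / n - (c + (d - c) * real j / n) = (d - c) / n"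
        by (simp add: diff_divide_distrib[symmetric] algebra_simps)
      then show "expectation (\<lambda>x. (norm (s (c + (d - c) * real (Suc j) / n) x - s (c + (d - c) * real j / n) x))\<^sup>2)
          \<le> B ^ 3 / 4 * ((d - c) / n)\<^sup>2"
        using increment_second_moment(2)[of "c + (d - c) * real (Suc j) / n" "c + (d - c) * real j / n"] by simp
    qed simp
    also have "\<dots> = C" using False by (simp add: C_def power_divide power2_eq_square)
    finally show ?thesis .
  qed (simp add: Q_def \<open>C \<ge> 0\<close>)
  have "(\<integral>\<^sup>+x. liminf (\<lambda>n. ennreal (Q n x)) \<partial>M) \<le> liminf (\<lambda>n. \<integral>\<^sup>+x. ennreal (Q n x) \<partial>M)"
    by (rule nn_integral_liminf) measurable
  also have "\<dots> \<le> liminf (\<lambda>n::nat. ennreal C)"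
    using EQ Q_nn by (intro Liminf_mono) (auto simp: nn_integral_eq_integral[OF Qi] ennreal_leI)
  also have "\<dots> = ennreal C" by (simp add: Liminf_const)
  finally have "(\<integral>\<^sup>+x. liminf (\<lambda>n. ennreal (Q n x)) \<partial>M) \<noteq> \<infinity>"
    using ennreal_less_top[of C] by (auto simp: top_unique)
  then have "AE x in M. liminf (\<lambda>n. ennreal (Q n x)) \<noteq> \<infinity>"
    by (intro nn_integral_noteq_infinite) auto
  with cont show ?thesis
  proof eventually_elim
    case (elim x)
    then obtain L where L: "liminf (\<lambda>n. ennreal (Q n x)) = ennreal L" "0 \<le> L"
      by (cases "liminf (\<lambda>n. ennreal (Q n x))") auto
    \<comment> \<open>Strictly above the limes inferior, so that \<open>Q n x\<close> falls below
      \<open>K\<close> infinitely often.\<close>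
    define K where "K = L + 1"
    have K: "liminf (\<lambda>n. ennreal (Q n x)) < ennreal K"
      using L by (simp add: K_def ennreal_less_iff)
    have "\<exists>\<^sub>F n in sequentially. Q n x \<le> K"
    proof (rule ccontr)
      assume "\<not> ?thesis"
      then have "\<forall>\<^sub>F n in sequentially. ennreal K \<le> ennreal (Q n x)"
        by (auto simp: not_frequently elim!: eventually_mono intro!: ennreal_leI)
      then have "ennreal K \<le> liminf (\<lambda>n. ennreal (Q n x))" by (rule Liminf_bounded)
      with K show False by simp
    qed
    then have "\<exists>\<^sub>F n in sequentially. Q n x \<le> K / (d - c) * (d - c)"
      using assms by simp
    then have "(norm (s u x - s v x))\<^sup>2 \<le> K / (d - c) * \<bar>u - v\<bar>" if "u \<in> {c..d}" "v \<in> {c..d}" for u v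
      using that assms continuous_on_subset[OF elim(1)] unfolding Q_def
      by (intro holder_half_of_increments[where c=c and d=d and f="\<lambda>u. s u x"]) auto
    then show ?case by blast
  qed
qed

end

section \<open>Proportional samples\<close>

text \<open>The defect, in entry \<open>k\<close>, of the second column being \<open>\<mu>\<close>
  times the first, after division by the phase of the second; \<open>\<nu>\<close> stands for the
  frequency difference. The function \<open>g\<close> is left open so that both a path and a pure
  exponential can be inserted.\<close>

definition sample_gap :: "(nat \<Rightarrow> real) \<Rightarrow> (real \<Rightarrow> complex) \<Rightarrow> real \<Rightarrow> real \<Rightarrow> real \<Rightarrow> complex \<Rightarrow> nat \<Rightarrow> complex" where
  "sample_gap t g \<tau>0 \<tau> \<nu> \<mu> k = g (t k - \<tau>) - \<mu> * cis (- \<nu> * t k) * g (t k - \<tau>0)"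

text \<open>The gap is Lipschitz in \<open>\<nu>\<close> and \<open>\<mu>\<close> but only Hoelder
  of exponent 1/2 in \<open>\<tau>\<close>. A displacement of order \<open>\<delta>\<^sup>2\<close>
  in \<open>\<tau>\<close> thus costs as much as one of order \<open>\<delta>\<close> in the
  others.\<close>

lemma sample_gap_perturb:
  fixes t g
  assumes "(norm (g (t k - \<tau>) - g (t k - \<tau>')))\<^sup>2 \<le> H * \<bar>\<tau> - \<tau>'\<bar>" "\<bar>\<tau> - \<tau>'\<bar> \<le> \<delta>\<^sup>2" "H \<ge> 0" "\<delta> \<ge> 0"
    and "\<bar>\<nu> - \<nu>'\<bar> \<le> \<delta>" "norm (\<mu> - \<mu>') \<le> \<delta>" "norm \<mu>' \<le> R" "norm (g (t k - \<tau>0)) \<le> R"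
    and "sample_gap t g \<tau>0 \<tau> \<nu> \<mu> k = 0"
  shows "norm (sample_gap t g \<tau>0 \<tau>' \<nu>' \<mu>' k) \<le> (sqrt H + (1 + R * \<bar>t k\<bar>) * R) * \<delta>"
proof -
  have "R \<ge> 0" using assms(7) norm_ge_zero order_trans by blast
  have "(norm (g (t k - \<tau>) - g (t k - \<tau>')))\<^sup>2 \<le> H * \<delta>\<^sup>2"
    using assms(1) mult_left_mono[OF assms(2,3)] by linarith
  also have "\<dots> = (sqrt H * \<delta>)\<^sup>2" using \<open>H \<ge> 0\<close> by (simp add: power_mult_distrib)
  finally have 1: "norm (g (t k - \<tau>) - g (t k - \<tau>')) \<le> sqrt H * \<delta>"
    using \<open>H \<ge> 0\<close> \<open>\<delta> \<ge> 0\<close> by (meson mult_nonneg_nonneg power2_le_imp_le real_sqrt_ge_zero)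
  have "norm (\<mu> * cis (- \<nu> * t k) - \<mu>' * cis (- \<nu>' * t k))
      = norm ((\<mu> - \<mu>') * cis (- \<nu> * t k) + \<mu>' * (cis (- \<nu> * t k) - cis (- \<nu>' * t k)))"
    by (simp add: algebra_simps)
  also have "\<dots> \<le> norm (\<mu> - \<mu>') + norm \<mu>' * norm (cis (- \<nu> * t k) - cis (- \<nu>' * t k))"
    by (rule norm_triangle_le) (simp add: norm_mult)
  also have "\<dots> \<le> \<delta> + R * (\<bar>t k\<bar> * \<delta>)"
  proof (intro add_mono mult_mono assms)
    have "norm (cis (- \<nu> * t k) - cis (- \<nu>' * t k)) \<le> \<bar>(\<nu>' - \<nu>) * t k\<bar>"
      using norm_cis_diff_le[of "- \<nu> * t k" "- \<nu>' * t k"] by (simp add: algebra_simps)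
    also have "\<dots> \<le> \<bar>t k\<bar> * \<delta>"
      unfolding abs_mult using assms(5) by (subst mult.commute) (auto intro!: mult_left_mono)
    finally show "norm (cis (- \<nu> * t k) - cis (- \<nu>' * t k)) \<le> \<bar>t k\<bar> * \<delta>" .
  qed (use \<open>R \<ge> 0\<close> in auto)
  finally have "norm (\<mu> * cis (- \<nu> * t k) - \<mu>' * cis (- \<nu>' * t k)) \<le> (1 + R * \<bar>t k\<bar>) * \<delta>"
    by (simp add: algebra_simps)
  then have 2: "norm ((\<mu> * cis (- \<nu> * t k) - \<mu>' * cis (- \<nu>' * t k)) * g (t k - \<tau>0)) \<le> (1 + R * \<bar>t k\<bar>) * \<delta> * R"
    unfolding norm_mult using assms(4,8) \<open>R \<ge> 0\<close> by (intro mult_mono) auto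
  have "sample_gap t g \<tau>0 \<tau>' \<nu>' \<mu>' k =
      (\<mu> * cis (- \<nu> * t k) - \<mu>' * cis (- \<nu>' * t k)) * g (t k - \<tau>0) - (g (t k - \<tau>) - g (t k - \<tau>'))"
    using assms(9) by (simp add: sample_gap_def algebra_simps)
  then have "norm (sample_gap t g \<tau>0 \<tau>' \<nu>' \<mu>' k) \<le> (1 + R * \<bar>t k\<bar>) * \<delta> * R + sqrt H * \<delta>"
    using norm_triangle_ineq4[of "(\<mu> * cis (- \<nu> * t k) - \<mu>' * cis (- \<nu>' * t k)) * g (t k - \<tau>0)"
        "g (t k - \<tau>) - g (t k - \<tau>')"] add_mono[OF 2 1] by (simp only:)
  then show ?thesis by (simp add: algebra_simps)
qed

text \<open>The Hermitian covariance form of the three gaps of the process, written in the spectral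
  domain.\<close>

definition gap_energy ::
  "real \<Rightarrow> (nat \<Rightarrow> real) \<Rightarrow> real \<Rightarrow> real \<Rightarrow> real \<Rightarrow> complex \<Rightarrow> (nat \<Rightarrow> complex) \<Rightarrow> real" where
  "gap_energy B t \<tau>0 \<tau> \<nu> \<mu> c = integral {-B/2..B/2}
     (\<lambda>f. (norm (\<Sum>k<3. c k * sample_gap t (\<lambda>u. cis (f * u)) \<tau>0 \<tau> \<nu> \<mu> k))\<^sup>2)"

lemma gap_energy_scale:
  "gap_energy B t \<tau>0 \<tau> \<nu> \<mu> (\<lambda>k. of_real r * c k) = r\<^sup>2 * gap_energy B t \<tau>0 \<tau> \<nu> \<mu> c"
  unfolding gap_energy_def
  by (simp add: mult.assoc sum_distrib_left[symmetric] norm_mult power_mult_distrib)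

section \<open>Uniform nondegeneracy of the gaps\<close>

context
  fixes t :: "nat \<Rightarrow> real" and \<tau>0 a b B :: real
  assumes t: "t 0 < t 1" "t 1 < t 2" and \<tau>0: "\<tau>0 \<notin> {a..b}" and B: "B > 0"
begin

text \<open>Zero energy forces the continuous exponential sum to vanish on the band, hence
  identically. Its exponents are \<open>t k - \<tau>\<close> and the same shifted by
  \<open>\<tau> - \<tau>0\<close>, which is nonzero, so independence of shifted exponentials kills
  all \<open>c k\<close>.\<close>

lemma gap_energy_pos:
  assumes "\<tau> \<in> {a..b}" and "\<exists>k<3. c k \<noteq> 0"
  shows "gap_energy B t \<tau>0 \<tau> \<nu> \<mu> c > 0"
proof (rule ccontr)
  let ?p = "\<lambda>f. \<Sum>k<3. c k * sample_gap t (\<lambda>u. cis (f * u)) \<tau>0 \<tau> \<nu> \<mu> k"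
  assume "\<not> gap_energy B t \<tau>0 \<tau> \<nu> \<mu> c > 0"
  moreover have "gap_energy B t \<tau>0 \<tau> \<nu> \<mu> c \<ge> 0"
    unfolding gap_energy_def sample_gap_def
    by (intro integral_nonneg integrable_continuous_interval continuous_intros) auto
  ultimately have "integral {-B/2..B/2} (\<lambda>f. (norm (?p f))\<^sup>2) = 0"
    by (simp add: gap_energy_def)
  moreover have "continuous_on {-B/2..B/2} (\<lambda>f. (norm (?p f))\<^sup>2)"
    unfolding sample_gap_def by (intro continuous_intros)
  ultimately have p0: "?p f = 0" if "f \<in> {-B/2..B/2}" for f
    using integral_eq_0_iff[of "-B/2" "B/2" "\<lambda>f. (norm (?p f))\<^sup>2"] B that by auto
  define \<eta> where "\<eta> = (\<lambda>k. \<mu> * cis (- \<nu> * t k))"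
  define J :: "(nat + nat) set" where "J = {..<3} <+> {..<3}"
  define d where "d = case_sum c (\<lambda>k. - c k * \<eta> k)"
  define u where "u = case_sum (\<lambda>k. t k - \<tau>) (\<lambda>k. t k - \<tau>0)"
  have "(\<Sum>j\<in>J. d j * cis (f * u j)) = ?p f" for f
    by (simp add: J_def sum.Plus d_def u_def \<eta>_def sample_gap_def sum_subtractf sum_negf right_diff_distrib mult_ac)
  then have "(\<Sum>j\<in>J. d j * exp (z * of_real (u j))) = 0" for z
    using p0 B by (intro exponential_sum_eq_0_extend[of "-B/2" "B/2"]) auto
  moreover have "(\<Sum>j\<in>J. d j * exp (z * of_real (u j))) =
     (\<Sum>k<3. c k * (exp (z * of_real (t k - \<tau>)) - \<eta> k * exp (z * of_real (t k - \<tau> + (\<tau> - \<tau>0)))))" for z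
    by (simp add: J_def sum.Plus d_def u_def sum_subtractf sum_negf right_diff_distrib mult_ac)
  ultimately have zero: "(\<Sum>k<3. c k * (exp (z * of_real (t k - \<tau>)) - \<eta> k * exp (z * of_real (t k - \<tau> + (\<tau> - \<tau>0))))) = 0" for z
    by metis
  have "t k - \<tau> < t l - \<tau>" if "k < l" "l < 3" for k l
    using that t by (auto simp: less_Suc_eq numeral_3_eq_3 numeral_2_eq_2)
  then have "c k = 0" if "k < 3" for k
    using shifted_exponentials_independent[OF _ _ zero that] assms(1) \<tau>0 by auto
  with assms(2) show False by auto
qed

text \<open>The energy is continuous and positive on a compact set of parameters and unit
  coefficient vectors, so its minimum there is positive; quadratic homogeneity extends the bound to
  all coefficients.\<close>

lemma gap_energy_lower_bound:
  assumes "a \<le> b" "R \<ge> 0"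
  obtains \<kappa> where "\<kappa> > 0"
    "\<And>\<tau> \<nu> \<mu> c. \<tau> \<in> {a..b} \<Longrightarrow> \<nu> \<in> {-R..R} \<Longrightarrow> norm \<mu> \<le> R \<Longrightarrow>
       \<kappa> * (\<Sum>k<3. (norm (c k))\<^sup>2) \<le> gap_energy B t \<tau>0 \<tau> \<nu> \<mu> c"
proof -
  \<comment> \<open>Coefficients are encoded as triples, whose unit sphere is compact.\<close>
  define cf where "cf = (\<lambda>(w :: complex \<times> complex \<times> complex) k.
    if k = 0 then fst w else if k = (1::nat) then fst (snd w) else snd (snd w))"
  define K where "K = {a..b} \<times> {-R..R} \<times> cball (0::complex) R \<times> sphere (0 :: complex \<times> complex \<times> complex) 1"
  define G where "G = (\<lambda>(\<tau>, \<nu>, \<mu>, w). gap_energy B t \<tau>0 \<tau> \<nu> \<mu> (cf w))"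
  have nsq: "(\<Sum>k<3. (norm (cf w k))\<^sup>2) = (norm w)\<^sup>2" for w
    by (cases w) (auto simp: cf_def norm_Pair numeral_3_eq_3)
  have cf_cont: "continuous_on S (\<lambda>x. cf (h x) k)" if "continuous_on S h" for S k
    and h :: "(real \<times> real \<times> complex \<times> complex \<times> complex \<times> complex) \<times> real \<Rightarrow> _"
    unfolding cf_def using that by (cases "k = 0"; cases "k = 1") (auto intro!: continuous_intros)
  have "compact K" unfolding K_def by (intro compact_Times compact_sphere compact_cball compact_Icc)
  moreover have "(1, 0, 0) \<in> sphere (0 :: complex \<times> complex \<times> complex) 1" by (simp add: norm_Pair)
  then have "K \<noteq> {}" unfolding K_def using assms by (auto intro!: exI[of _ "0::real"])
  moreover have "continuous_on K G"
  proof -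
    have "continuous_on (K \<times> cbox (-B/2) (B/2)) (\<lambda>(y, f). case y of (\<tau>, \<nu>, \<mu>, w) \<Rightarrow>
        (norm (\<Sum>k<3. cf w k * sample_gap t (\<lambda>u. cis (f * u)) \<tau>0 \<tau> \<nu> \<mu> k))\<^sup>2)"
      unfolding split_beta sample_gap_def by (intro continuous_intros cf_cont)
    then have "continuous_on K (\<lambda>y. integral (cbox (-B/2) (B/2)) (\<lambda>f. case y of (\<tau>, \<nu>, \<mu>, w) \<Rightarrow>
        (norm (\<Sum>k<3. cf w k * sample_gap t (\<lambda>u. cis (f * u)) \<tau>0 \<tau> \<nu> \<mu> k))\<^sup>2))"
      by (rule integral_continuous_on_param)
    then show ?thesis
      by (simp add: G_def gap_energy_def split_beta)
  qed
  ultimately obtain y where y: "y \<in> K" "\<And>z. z \<in> K \<Longrightarrow> G y \<le> G z"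
    using continuous_attains_inf[of K G] by blast
  obtain \<tau>1 \<nu>1 \<mu>1 w1 where y_eq: "y = (\<tau>1, \<nu>1, \<mu>1, w1)" by (cases y)
  show ?thesis
  proof
    have "norm w1 = 1" "\<tau>1 \<in> {a..b}" using y(1) by (auto simp: y_eq K_def)
    then have "(\<Sum>k<3. (norm (cf w1 k))\<^sup>2) \<noteq> 0" by (simp add: nsq)
    then have "\<exists>k<3. cf w1 k \<noteq> 0" by (metis (no_types, lifting) lessThan_iff norm_zero power_zero_numeral sum.neutral)
    then show "G y > 0"
      using gap_energy_pos[OF \<open>\<tau>1 \<in> {a..b}\<close>] by (simp add: y_eq G_def)
  next
    fix \<tau> \<nu> :: real and \<mu> :: complex and c :: "nat \<Rightarrow> complex"
    assume *: "\<tau> \<in> {a..b}" "\<nu> \<in> {-R..R}" "norm \<mu> \<le> R"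
    define w where "w = (c 0, c 1, c 2)"
    have cw: "c k = cf w k" if "k < 3" for k
      using that by (auto simp: w_def cf_def less_Suc_eq numeral_3_eq_3 numeral_2_eq_2)
    have energy_cong: "gap_energy B t \<tau>0 \<tau> \<nu> \<mu> c = gap_energy B t \<tau>0 \<tau> \<nu> \<mu> (cf w)"
    proof -
      have "(\<Sum>k<3. c k * sample_gap t (\<lambda>u. cis (f * u)) \<tau>0 \<tau> \<nu> \<mu> k) =
          (\<Sum>k<3. cf w k * sample_gap t (\<lambda>u. cis (f * u)) \<tau>0 \<tau> \<nu> \<mu> k)" for f
        by (intro sum.cong) (auto simp: cw)
      then show ?thesis by (simp only: gap_energy_def)
    qed
    have sum_w: "(\<Sum>k<3. (norm (c k))\<^sup>2) = (norm w)\<^sup>2"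
      unfolding nsq[symmetric] by (intro sum.cong) (auto simp: cw)
    show "G y * (\<Sum>k<3. (norm (c k))\<^sup>2) \<le> gap_energy B t \<tau>0 \<tau> \<nu> \<mu> c"
    proof (cases "w = 0")
      case True
      have "0 \<le> gap_energy B t \<tau>0 \<tau> \<nu> \<mu> c"
        unfolding gap_energy_def sample_gap_def
        by (intro integral_nonneg integrable_continuous_interval continuous_intros) auto
      then show ?thesis using True by (simp add: sum_w)
    next
      case False
      define v where "v = (1 / norm w) *\<^sub>R w"
      have "norm v = 1" using False by (simp add: v_def)
      then have "G y \<le> gap_energy B t \<tau>0 \<tau> \<nu> \<mu> (cf v)"
        using y(2)[of "(\<tau>, \<nu>, \<mu>, v)"] * by (simp add: K_def G_def)
      moreover have "cf w = (\<lambda>k. of_real (norm w) * cf v k)"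
        using False by (auto simp: v_def cf_def fun_eq_iff scaleR_conv_of_real)
      then have "gap_energy B t \<tau>0 \<tau> \<nu> \<mu> (cf w) = (norm w)\<^sup>2 * gap_energy B t \<tau>0 \<tau> \<nu> \<mu> (cf v)"
        by (simp add: gap_energy_scale)
      ultimately show ?thesis
        by (simp add: energy_cong sum_w mult.commute[of "G y"] mult_left_mono)
    qed
  qed
qed

end

section \<open>Probability that the gaps are small, and almost sure absence of common zeros\<close>

context lowpass_process
begin

text \<open>The real part alone is Gaussian with variance \<open>B/2\<close>, so the one-dimensional
  small-ball bound tends to 0 with the radius.\<close>

lemma AE_s_nonzero: "AE x in M. s u x \<noteq> 0"
proof -
  have small: "prob {x \<in> space M. \<forall>i\<in>{()}. \<bar>Re (s u x)\<bar> \<le> \<epsilon>} \<le> (exp (1/2) * \<epsilon> / sqrt (B/2)) ^ card {()}"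
    if "\<epsilon> > 0" for \<epsilon>
  proof (rule gaussian_small_ball[where V="\<lambda>\<zeta>. B/2 * (\<zeta> ())\<^sup>2"])
    fix \<zeta> :: "unit \<Rightarrow> real"
    have "spectral_energy {()} (\<lambda>i. of_real (\<zeta> i)) (\<lambda>_. u) = B * (\<zeta> ())\<^sup>2"
      using B_pos by (simp add: spectral_energy_def norm_mult)
    then show "expectation (\<lambda>x. exp (\<i> * of_real (\<Sum>i\<in>{()}. \<zeta> i * Re (s u x)))) =
        of_real (exp (- (B/2 * (\<zeta> ())\<^sup>2) / 2))"
      using char_combination[of "{()}" "\<lambda>i. of_real (\<zeta> i)" "\<lambda>_. u"] by simp
  qed (use B_pos that in auto)
  define A where "A = {x \<in> space M. Re (s u x) = 0}"
  have A: "A \<in> sets M" unfolding A_def by measurable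
  have "prob A \<le> 0"
  proof (rule field_le_epsilon)
    fix e :: real assume "e > 0"
    define \<epsilon> where "\<epsilon> = e * sqrt (B/2) / exp (1/2)"
    have "\<epsilon> > 0" using \<open>e > 0\<close> B_pos by (simp add: \<epsilon>_def)
    have "prob A \<le> prob {x \<in> space M. \<forall>i\<in>{()}. \<bar>Re (s u x)\<bar> \<le> \<epsilon>}"
      using \<open>\<epsilon> > 0\<close> by (intro finite_measure_mono) (auto simp: A_def)
    also have "\<dots> \<le> e"
      using small[OF \<open>\<epsilon> > 0\<close>] B_pos by (simp add: \<epsilon>_def)
    finally show "prob A \<le> 0 + e" by simp
  qed
  then have "prob A = 0" by (simp add: measure_le_0_iff)
  then have "A \<in> null_sets M" using A by (auto simp: emeasure_eq_measure)
  then show ?thesis by (rule AE_I') (auto simp: A_def)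
qed

lemma measurable_sample_gap [measurable]:
  "(\<lambda>x. sample_gap t (\<lambda>u. s u x) \<tau>0 \<tau> \<nu> \<mu> k) \<in> borel_measurable M"
  unfolding sample_gap_def by measurable

text \<open>The real and imaginary parts of the three gaps form six real coordinates, hence the
  exponent. Their real covariance form is half the Hermitian one, hence
  \<open>\<kappa>/2\<close>.\<close>

lemma sample_gap_small_ball:
  assumes \<kappa>: "\<And>c. \<kappa> * (\<Sum>k<3. (norm (c k))\<^sup>2) \<le> gap_energy B t \<tau>0 \<tau> \<nu> \<mu> c" and "\<kappa> > 0" "\<epsilon> > 0"
  shows "prob {x \<in> space M. \<forall>k<3. norm (sample_gap t (\<lambda>u. s u x) \<tau>0 \<tau> \<nu> \<mu> k) \<le> \<epsilon>}
    \<le> (exp (1/2) * \<epsilon> / sqrt (\<kappa>/2)) ^ 6"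
proof -
  define L where "L = (\<lambda>k x. sample_gap t (\<lambda>u. s u x) \<tau>0 \<tau> \<nu> \<mu> k)"
  define I where "I = {..<3::nat} \<times> (UNIV :: bool set)"
  define Z where "Z = (\<lambda>(k, im) x. if im then Im (L k x) else Re (L k x))"
  \<comment> \<open>The conjugated sign turns a real combination of real and imaginary parts into
    the real part of one complex combination:
    \<open>Re ((p - \<i> * q) * z) = p * Re z + q * Im z\<close> for real \<open>p\<close>,
    \<open>q\<close>.\<close>
  define cf where "cf = (\<lambda>\<zeta> k::nat. Complex (\<zeta> (k, False)) (- \<zeta> (k, True)))"
  define J :: "(nat + nat) set" where "J = {..<3} <+> {..<3}"
  have finJ: "finite J" by (simp add: J_def)
  define d where "d = (\<lambda>c. case_sum c (\<lambda>k. - c k * (\<mu> * cis (- \<nu> * t k))))"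
  define u where "u = case_sum (\<lambda>k. t k - \<tau>) (\<lambda>k. t k - \<tau>0)"
  have comb: "(\<Sum>j\<in>J. d c j * g (u j)) = (\<Sum>k<3. c k * sample_gap t g \<tau>0 \<tau> \<nu> \<mu> k)" for c and g :: "real \<Rightarrow> complex"
    by (simp add: J_def sum.Plus d_def u_def sample_gap_def sum_subtractf sum_negf right_diff_distrib mult_ac)
  have energy: "spectral_energy J (d c) u = gap_energy B t \<tau>0 \<tau> \<nu> \<mu> c" for c
    using comb[of c "\<lambda>u. cis (f * u)" for f] by (simp add: spectral_energy_def gap_energy_def)
  have "prob {x \<in> space M. \<forall>i\<in>I. \<bar>Z i x\<bar> \<le> \<epsilon>} \<le> (exp (1/2) * \<epsilon> / sqrt (\<kappa>/2)) ^ card I"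
  proof (rule gaussian_small_ball[where V="\<lambda>\<zeta>. gap_energy B t \<tau>0 \<tau> \<nu> \<mu> (cf \<zeta>) / 2"])
    show "Z i \<in> borel_measurable M" for i
      by (cases i; cases "snd i") (auto simp: Z_def L_def)
    fix \<zeta>
    have "(\<Sum>i\<in>I. \<zeta> i * Z i x) = Re (\<Sum>j\<in>J. d (cf \<zeta>) j * s (u j) x)" for x
      unfolding comb[of _ "\<lambda>u. s u x"]
      by (simp add: I_def sum.cartesian_product' sum.distrib UNIV_bool Z_def cf_def L_def)
    then show "expectation (\<lambda>x. exp (\<i> * of_real (\<Sum>i\<in>I. \<zeta> i * Z i x)))
        = of_real (exp (- (gap_energy B t \<tau>0 \<tau> \<nu> \<mu> (cf \<zeta>) / 2) / 2))"
      using char_combination[OF finJ, of "d (cf \<zeta>)" u] by (simp only: energy)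
    have "(\<Sum>i\<in>I. (\<zeta> i)\<^sup>2) = (\<Sum>k<3. (norm (cf \<zeta> k))\<^sup>2)"
      by (simp add: I_def sum.cartesian_product' sum.distrib UNIV_bool cf_def cmod_power2)
    then show "\<kappa>/2 * (\<Sum>i\<in>I. (\<zeta> i)\<^sup>2) \<le> gap_energy B t \<tau>0 \<tau> \<nu> \<mu> (cf \<zeta>) / 2"
      using \<kappa>[of "cf \<zeta>"] by simp
  qed (use assms in \<open>auto simp: I_def\<close>)
  moreover have "prob {x \<in> space M. \<forall>k<3. norm (L k x) \<le> \<epsilon>} \<le> prob {x \<in> space M. \<forall>i\<in>I. \<bar>Z i x\<bar> \<le> \<epsilon>}"
  proof (rule finite_measure_mono)
    show "{x \<in> space M. \<forall>k<3. norm (L k x) \<le> \<epsilon>} \<subseteq> {x \<in> space M. \<forall>i\<in>I. \<bar>Z i x\<bar> \<le> \<epsilon>}"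
      using abs_Re_le_cmod abs_Im_le_cmod by (auto simp: I_def Z_def intro: order_trans)
    have "Z i \<in> borel_measurable M" for i
      by (cases i; cases "snd i") (auto simp: Z_def L_def)
    then show "{x \<in> space M. \<forall>i\<in>I. \<bar>Z i x\<bar> \<le> \<epsilon>} \<in> events"
      by (simp add: I_def)
  qed
  moreover have "card I = 6" by (simp add: I_def card_cartesian_product)
  ultimately show ?thesis by (simp add: L_def)
qed

text \<open>One deterministic \<open>R\<close> bounds the Hoelder constant, the reference samples,
  \<open>\<nu>\<close> and \<open>\<mu>\<close>, so that the constants of the grid argument do not
  depend on the path.\<close>

lemma AE_no_gap_zero_bounded:
  fixes R :: real
  assumes t: "t 0 < t 1" "t 1 < t 2" and \<tau>0: "\<tau>0 \<notin> {a..b}" and ab: "a \<le> b" and R: "R \<ge> 0"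
  shows "AE x in M.
    (\<forall>u\<in>{t 0 - b - 1..t 2 - a + 1}. \<forall>v\<in>{t 0 - b - 1..t 2 - a + 1}. (norm (s u x - s v x))\<^sup>2 \<le> R * \<bar>u - v\<bar>) \<longrightarrow>
    (\<forall>k<3. norm (s (t k - \<tau>0) x) \<le> R) \<longrightarrow>
    (\<forall>\<tau>\<in>{a..b}. \<forall>\<nu>\<in>{-R..R}. \<forall>\<mu>. norm \<mu> \<le> R \<longrightarrow> (\<exists>k<3. sample_gap t (\<lambda>u. s u x) \<tau>0 \<tau> \<nu> \<mu> k \<noteq> 0))"
    (is "AE x in M. ?holder x \<longrightarrow> ?bdd x \<longrightarrow> ?ok x")
proof -
  \<comment> \<open>The radius is doubled because a grid value
    \<open>Complex \<alpha> \<beta>\<close> with coordinates in \<open>{-R..R}\<close> may have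
    modulus above \<open>R\<close>, but at most \<open>2 * R\<close>.\<close>
  obtain \<kappa> where \<kappa>: "\<kappa> > 0"
    "\<And>\<tau> \<nu> \<mu> c. \<tau> \<in> {a..b} \<Longrightarrow> \<nu> \<in> {-(2*R)..2*R} \<Longrightarrow> norm \<mu> \<le> 2 * R \<Longrightarrow>
       \<kappa> * (\<Sum>k<3. (norm (c k))\<^sup>2) \<le> gap_energy B t \<tau>0 \<tau> \<nu> \<mu> c"
    using gap_energy_lower_bound[OF t \<tau>0 B_pos ab, of "2 * R"] R by auto
  \<comment> \<open>\<open>\<delta> = D / n\<close> covers every grid error:
    \<open>D \<ge> 1\<close> gives \<open>b - a \<le> D\<^sup>2\<close> for the fine grid in
    \<open>\<tau>\<close>, and \<open>4 * R\<close> adds the errors \<open>2 * R / n\<close> of the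
    two coordinates of \<open>\<mu>\<close>.\<close>
  define D where "D = (b - a) + 4 * R + 1"
  \<comment> \<open>The constant of \<open>sample_gap_perturb\<close> with bound
    \<open>2 * R\<close>, made uniform in \<open>k\<close> by the sum; the final 1 makes it
    positive.\<close>
  define C where "C = (sqrt R + (1 + 2 * R * (\<Sum>k<3. \<bar>t k\<bar>)) * (2 * R) + 1) * D"
  define E where "E = (\<lambda>n \<tau> \<nu> \<mu>. {x \<in> space M. \<forall>k<3. norm (sample_gap t (\<lambda>u. s u x) \<tau>0 \<tau> \<nu> \<mu> k) \<le> C / real n})"
  define K where "K = 16 * (exp (1/2) * C / sqrt (\<kappa>/2)) ^ 6"
  have D1: "D \<ge> 1" using ab R by (simp add: D_def)
  have "C > 0" unfolding C_def using R D1
    by (intro mult_pos_pos add_nonneg_pos add_nonneg_nonneg mult_nonneg_nonneg sum_nonneg) auto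
  have E_sets: "E n \<tau> \<nu> \<mu> \<in> sets M" for n \<tau> \<nu> \<mu> unfolding E_def by measurable
  have cover: "\<exists>A\<in>sets M. {x \<in> space M. \<not> (?holder x \<longrightarrow> ?bdd x \<longrightarrow> ?ok x)} \<subseteq> A \<and> prob A \<le> K / real n"
    if n: "n > 0" for n :: nat
  proof -
    obtain G1 where G1: "finite G1" "G1 \<subseteq> {a..b}" "card G1 \<le> n\<^sup>2 + 1"
      "\<And>x. x \<in> {a..b} \<Longrightarrow> \<exists>y\<in>G1. \<bar>x - y\<bar> \<le> (b - a) / real (n\<^sup>2)"
      using finite_grid[OF ab, of "n\<^sup>2"] n by auto
    obtain G2 where G2: "finite G2" "G2 \<subseteq> {-R..R}" "card G2 \<le> n + 1"
      "\<And>x. x \<in> {-R..R} \<Longrightarrow> \<exists>y\<in>G2. \<bar>x - y\<bar> \<le> (R - (- R)) / real n"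
      using finite_grid[of "-R" R n] n R by auto
    define P where "P = G1 \<times> G2 \<times> G2 \<times> G2"
    have finP: "finite P" using G1 G2 by (simp add: P_def)
    define F where "F = (\<lambda>(\<tau>, \<nu>, \<alpha>, \<beta>). E n \<tau> \<nu> (Complex \<alpha> \<beta>))"
    have norm_box: "norm (Complex \<alpha> \<beta>) \<le> 2 * R" if "\<alpha> \<in> {-R..R}" "\<beta> \<in> {-R..R}" for \<alpha> \<beta>
      using that cmod_le[of "Complex \<alpha> \<beta>"] by auto
    have F_prob: "prob (F p) \<le> (exp (1/2) * (C / real n) / sqrt (\<kappa>/2)) ^ 6" if "p \<in> P" for p
    proof -
      obtain \<tau> \<nu> \<alpha> \<beta> where p: "p = (\<tau>, \<nu>, \<alpha>, \<beta>)" by (cases p)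
      then have "\<tau> \<in> {a..b}" "\<nu> \<in> {-R..R}" "\<alpha> \<in> {-R..R}" "\<beta> \<in> {-R..R}"
        using that G1(2) G2(2) by (auto simp: P_def)
      then show ?thesis
        unfolding p F_def E_def prod.case using n \<open>C > 0\<close> norm_box R
        by (intro sample_gap_small_ball \<kappa>) auto
    qed
    have "real (card P) \<le> real ((n\<^sup>2 + 1) * ((n + 1) * ((n + 1) * (n + 1))))"
      unfolding P_def card_cartesian_product of_nat_le_iff by (intro mult_mono G1 G2) auto
    \<comment> \<open>Each of the four grids has at most twice its number of cells as points; this
      is the 16 in \<open>K\<close>.\<close>
    also have "\<dots> \<le> real ((2 * n\<^sup>2) * ((2 * n) * ((2 * n) * (2 * n))))"
      unfolding of_nat_le_iff using n by (intro mult_mono) auto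
    also have "\<dots> = 16 * real n ^ 5"
      by (simp add: power_numeral_reduce)
    finally have cardP: "real (card P) \<le> 16 * real n ^ 5" .
    have "prob (\<Union> (F ` P)) \<le> (\<Sum>p\<in>P. prob (F p))"
      using finP E_sets by (intro finite_measure_subadditive_finite) (auto simp: F_def)
    also have "\<dots> \<le> real (card P) * (exp (1/2) * (C / real n) / sqrt (\<kappa>/2)) ^ 6"
      using sum_bounded_above[of P "\<lambda>p. prob (F p)", OF F_prob] by simp
    also have "\<dots> \<le> 16 * real n ^ 5 * (exp (1/2) * (C / real n) / sqrt (\<kappa>/2)) ^ 6"
      using cardP by (intro mult_right_mono) auto
    also have "\<dots> = K / real n"
    proof -
      define X where "X = exp (1/2) * C / sqrt (\<kappa>/2)"
      have "exp (1/2) * (C / real n) / sqrt (\<kappa>/2) = X / real n" by (simp add: X_def)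
      moreover have "real n ^ 6 = real n ^ 5 * real n" by (simp add: eval_nat_numeral)
      ultimately show ?thesis
        using n by (simp add: K_def X_def[symmetric] power_divide)
    qed
    finally have prob_le: "prob (\<Union> (F ` P)) \<le> K / real n" .
    have "{x \<in> space M. \<not> (?holder x \<longrightarrow> ?bdd x \<longrightarrow> ?ok x)} \<subseteq> \<Union> (F ` P)"
    proof
      fix x assume "x \<in> {x \<in> space M. \<not> (?holder x \<longrightarrow> ?bdd x \<longrightarrow> ?ok x)}"
      then obtain \<tau> \<nu> \<mu> where x: "x \<in> space M" "?holder x" "?bdd x"
        and par: "\<tau> \<in> {a..b}" "\<nu> \<in> {-R..R}" "norm \<mu> \<le> R"
        and zero: "\<And>k. k < 3 \<Longrightarrow> sample_gap t (\<lambda>u. s u x) \<tau>0 \<tau> \<nu> \<mu> k = 0"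
        by auto
      have "Re \<mu> \<in> {-R..R}" "Im \<mu> \<in> {-R..R}"
        using abs_Re_le_cmod[of \<mu>] abs_Im_le_cmod[of \<mu>] par(3) by auto
      with G1(4)[OF par(1)] G2(4)[OF par(2)] G2(4)[of "Re \<mu>"] G2(4)[of "Im \<mu>"]
      obtain \<tau>' \<nu>' \<alpha> \<beta> where g: "\<tau>' \<in> G1" "\<nu>' \<in> G2" "\<alpha> \<in> G2" "\<beta> \<in> G2"
        and near: "\<bar>\<tau> - \<tau>'\<bar> \<le> (b - a) / real (n\<^sup>2)" "\<bar>\<nu> - \<nu>'\<bar> \<le> 2 * R / n"
          "\<bar>Re \<mu> - \<alpha>\<bar> \<le> 2 * R / n" "\<bar>Im \<mu> - \<beta>\<bar> \<le> 2 * R / n"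
        by auto
      define \<delta> where "\<delta> = D / real n"
      have "norm (sample_gap t (\<lambda>u. s u x) \<tau>0 \<tau>' \<nu>' (Complex \<alpha> \<beta>) k) \<le> C / real n" if k: "k < 3" for k
      proof -
        have tk: "t 0 \<le> t k" "t k \<le> t 2"
          using k t by (auto simp: less_Suc_eq numeral_3_eq_3 numeral_2_eq_2)
        have "norm (sample_gap t (\<lambda>u. s u x) \<tau>0 \<tau>' \<nu>' (Complex \<alpha> \<beta>) k)
            \<le> (sqrt R + (1 + 2 * R * \<bar>t k\<bar>) * (2 * R)) * \<delta>"
        proof (rule sample_gap_perturb)
          show "\<bar>\<tau> - \<tau>'\<bar> \<le> \<delta>\<^sup>2"
          proof -
            have "b - a \<le> D * 1" using R by (simp add: D_def)
            also have "\<dots> \<le> D\<^sup>2" unfolding power2_eq_square using D1 by (intro mult_left_mono) auto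
            finally have "(b - a) / real (n\<^sup>2) \<le> D\<^sup>2 / real (n\<^sup>2)" by (intro divide_right_mono) auto
            then show ?thesis using near(1) by (simp add: \<delta>_def power_divide)
          qed
          have le: "4 * R / n \<le> \<delta>" unfolding \<delta>_def D_def using ab by (intro divide_right_mono) auto
          moreover have "2 * R / n \<le> 4 * R / n" using R by (intro divide_right_mono) auto
          ultimately show "\<bar>\<nu> - \<nu>'\<bar> \<le> \<delta>" using near(2) by linarith
          have "norm (\<mu> - Complex \<alpha> \<beta>) \<le> \<bar>Re \<mu> - \<alpha>\<bar> + \<bar>Im \<mu> - \<beta>\<bar>"
            using cmod_le[of "\<mu> - Complex \<alpha> \<beta>"] by simp
          also have "\<dots> \<le> 2 * R / n + 2 * R / n" using near by (intro add_mono)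
          also have "\<dots> = 4 * R / n" by simp
          finally show "norm (\<mu> - Complex \<alpha> \<beta>) \<le> \<delta>" using le by linarith
          show "norm (Complex \<alpha> \<beta>) \<le> 2 * R" using norm_box g G2(2) by blast
          show "norm (s (t k - \<tau>0) x) \<le> 2 * R" using x(3) k R by (smt (verit))
          have "t k - \<tau> \<in> {t 0 - b - 1..t 2 - a + 1}" "t k - \<tau>' \<in> {t 0 - b - 1..t 2 - a + 1}"
            using tk par(1) g(1) G1(2) by auto
          then have "(norm (s (t k - \<tau>) x - s (t k - \<tau>') x))\<^sup>2 \<le> R * \<bar>t k - \<tau> - (t k - \<tau>')\<bar>"
            using x(2) by blast
          moreover have "\<bar>t k - \<tau> - (t k - \<tau>')\<bar> = \<bar>\<tau> - \<tau>'\<bar>" by linarith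
          ultimately show "(norm (s (t k - \<tau>) x - s (t k - \<tau>') x))\<^sup>2 \<le> R * \<bar>\<tau> - \<tau>'\<bar>" by simp
          show "\<delta> \<ge> 0" using D1 by (simp add: \<delta>_def)
        qed (use R zero[OF k] in auto)
        also have "\<dots> \<le> (sqrt R + (1 + 2 * R * (\<Sum>k<3. \<bar>t k\<bar>)) * (2 * R) + 1) * \<delta>"
        proof (rule mult_right_mono)
          have "\<bar>t k\<bar> \<le> (\<Sum>k<3. \<bar>t k\<bar>)" using k by (intro member_le_sum) auto
          then have "(1 + 2 * R * \<bar>t k\<bar>) * (2 * R) \<le> (1 + 2 * R * (\<Sum>k<3. \<bar>t k\<bar>)) * (2 * R)"
            using R by (intro mult_right_mono add_left_mono mult_left_mono) auto
          then show "sqrt R + (1 + 2 * R * \<bar>t k\<bar>) * (2 * R) \<le> sqrt R + (1 + 2 * R * (\<Sum>k<3. \<bar>t k\<bar>)) * (2 * R) + 1"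
            by linarith
          show "\<delta> \<ge> 0" using D1 by (simp add: \<delta>_def)
        qed
        also have "\<dots> = C / real n" by (simp add: C_def \<delta>_def)
        finally show ?thesis .
      qed
      then have "x \<in> F (\<tau>', \<nu>', \<alpha>, \<beta>)" using x(1) by (simp add: F_def E_def)
      moreover have "(\<tau>', \<nu>', \<alpha>, \<beta>) \<in> P" using g by (simp add: P_def)
      ultimately show "x \<in> \<Union> (F ` P)" by blast
    qed
    moreover have "\<Union> (F ` P) \<in> sets M"
      using finP E_sets by (intro sets.finite_UN) (auto simp: F_def)
    ultimately show ?thesis using prob_le by blast
  qed
  then show ?thesis by (rule AE_of_small_covers)
qed

text \<open>For a given path, \<open>\<nu>\<close> and \<open>\<mu>\<close>, some natural number
  exceeds all quantities bounded by \<open>R\<close> in the previous lemma, so a countable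
  intersection over such bounds suffices.\<close>

lemma AE_no_gap_zero:
  assumes t: "t 0 < t 1" "t 1 < t 2" and \<tau>0: "\<tau>0 \<notin> {a..b}" and ab: "a \<le> b"
  shows "AE x in M. \<forall>\<tau>\<in>{a..b}. \<forall>\<nu> \<mu>. \<exists>k<3. sample_gap t (\<lambda>u. s u x) \<tau>0 \<tau> \<nu> \<mu> k \<noteq> 0"
proof -
  let ?I = "{t 0 - b - 1..t 2 - a + 1}"
  have "AE x in M. \<forall>R::nat. (\<forall>u\<in>?I. \<forall>v\<in>?I. (norm (s u x - s v x))\<^sup>2 \<le> real R * \<bar>u - v\<bar>) \<longrightarrow>
    (\<forall>k<3. norm (s (t k - \<tau>0) x) \<le> real R) \<longrightarrow>
    (\<forall>\<tau>\<in>{a..b}. \<forall>\<nu>\<in>{-real R..real R}. \<forall>\<mu>. norm \<mu> \<le> real R \<longrightarrow> (\<exists>k<3. sample_gap t (\<lambda>u. s u x) \<tau>0 \<tau> \<nu> \<mu> k \<noteq> 0))"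
    unfolding AE_all_countable using AE_no_gap_zero_bounded[OF assms] by auto
  moreover have "AE x in M. \<exists>H. \<forall>u\<in>?I. \<forall>v\<in>?I. (norm (s u x - s v x))\<^sup>2 \<le> H * \<bar>u - v\<bar>"
    using t ab by (intro AE_holder_half) auto
  ultimately show ?thesis
  proof eventually_elim
    case (elim x)
    then obtain H where H: "\<And>u v. u \<in> ?I \<Longrightarrow> v \<in> ?I \<Longrightarrow> (norm (s u x - s v x))\<^sup>2 \<le> H * \<bar>u - v\<bar>" by blast
    show ?case
    proof (intro ballI allI)
      fix \<tau> \<nu> :: real and \<mu> :: complex assume \<tau>: "\<tau> \<in> {a..b}"
      define S where "S = \<bar>H\<bar> + \<bar>\<nu>\<bar> + norm \<mu> + (\<Sum>k<3. norm (s (t k - \<tau>0) x))"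
      have nn: "0 \<le> (\<Sum>k<3. norm (s (t k - \<tau>0) x))" by (simp add: sum_nonneg)
      obtain R :: nat where R: "S \<le> real R" using real_arch_simple by blast
      have "norm (s (t k - \<tau>0) x) \<le> real R" if "k < 3" for k
      proof -
        have "norm (s (t k - \<tau>0) x) \<le> (\<Sum>k<3. norm (s (t k - \<tau>0) x))"
          using that by (intro member_le_sum) auto
        then show ?thesis using R norm_ge_zero[of \<mu>] unfolding S_def by linarith
      qed
      moreover have "H \<le> real R" "- real R \<le> \<nu>" "\<nu> \<le> real R" "norm \<mu> \<le> real R"
        using R nn norm_ge_zero[of \<mu>] unfolding S_def by linarith+
      then have "H \<le> real R" "\<nu> \<in> {-real R..real R}" "norm \<mu> \<le> real R" by auto
      moreover have "(norm (s u x - s v x))\<^sup>2 \<le> real R * \<bar>u - v\<bar>" if "u \<in> ?I" "v \<in> ?I" for u v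
        using H[OF that] mult_right_mono[OF \<open>H \<le> real R\<close>, of "\<bar>u - v\<bar>"] by linarith
      ultimately show "\<exists>k<3. sample_gap t (\<lambda>u. s u x) \<tau>0 \<tau> \<nu> \<mu> k \<noteq> 0"
        using elim(1) \<tau> by blast
    qed
  qed
qed

end

text \<open>A dependence of the two columns yields a common zero of the first three gaps, with
  proportionality factor \<open>- \<alpha> / \<beta>\<close>; this is excluded on each of the
  finitely many intervals almost surely.\<close>

theorem theorem1:
  fixes M :: "'w measure"
    and s :: "real \<Rightarrow> 'w \<Rightarrow> complex"
    and B \<tau>0 \<omega>0 :: real
    and N :: nat and t :: "nat \<Rightarrow> real"
    and m :: nat and a b :: "nat \<Rightarrow> real" and T3 :: "real set"
  assumes "prob_space M"
    and gauss: "complex_gaussian_process M s"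
    and mean: "\<And>u. prob_space.expectation M (s u) = 0"
    and cov: "\<And>u u'. prob_space.expectation M (\<lambda>x. s u x * cnj (s u' x))
                 = spectral_cov (lowpass_density B) (u - u')"
    and circ: "\<And>u u'. prob_space.expectation M (\<lambda>x. s u x * s u' x) = 0"
    and cont: "AE x in M. continuous_on UNIV (\<lambda>u. s u x)"
    and "B > 0"
    and "N \<ge> 3"
    and "0 \<le> t 0"
    and "\<And>k l. k < l \<Longrightarrow> l < N \<Longrightarrow> t k < t l"
    and "T3 = (\<Union>i<m. {a i .. b i})"
    and "\<And>i. i < m \<Longrightarrow> a i \<le> b i"
    and "\<And>i j. i < m \<Longrightarrow> j < m \<Longrightarrow> i \<noteq> j \<Longrightarrow> {a i .. b i} \<inter> {a j .. b j} = {}"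
    and "\<And>i. i < m \<Longrightarrow> \<tau>0 \<notin> {a i .. b i}"
  shows "AE x in M. \<not> (\<exists>(\<tau>, \<omega>) \<in> T3 \<times> UNIV.
            vec_space.rank N (sample_mat N t s \<tau>0 \<omega>0 \<tau> \<omega> x) = 1)"
proof -
  interpret lowpass_process M s B
    using assms by (intro lowpass_process.intro lowpass_process_axioms.intro)
  have t: "t 0 < t 1" "t 1 < t 2" using assms(10)[of 0 1] assms(10)[of 1 2] \<open>N \<ge> 3\<close> by auto
  have "AE x in M. \<forall>i\<in>{..<m}. \<forall>\<tau>\<in>{a i..b i}. \<forall>\<nu> \<mu>. \<exists>k<3. sample_gap t (\<lambda>u. s u x) \<tau>0 \<tau> \<nu> \<mu> k \<noteq> 0"
    using assms(12,14) by (intro AE_ball_countable[THEN iffD2] ballI AE_no_gap_zero[OF t]) auto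
  then show ?thesis
    using AE_s_nonzero[of "t 0 - \<tau>0"]
  proof eventually_elim
    case (elim x)
    show ?case
    proof safe
      fix \<tau> \<omega>
      assume \<tau>: "\<tau> \<in> T3" and rk: "vec_space.rank N (sample_mat N t s \<tau>0 \<omega>0 \<tau> \<omega> x) = 1"
      obtain \<alpha> \<beta> where \<alpha>\<beta>: "\<alpha> \<noteq> 0 \<or> \<beta> \<noteq> 0"
        and dep: "\<And>k. k < N \<Longrightarrow> \<alpha> * sample_mat N t s \<tau>0 \<omega>0 \<tau> \<omega> x $$ (k, 0) + \<beta> * sample_mat N t s \<tau>0 \<omega>0 \<tau> \<omega> x $$ (k, 1) = 0"
        using rank_one_imp_columns_dependent[OF _ rk] by (auto simp: sample_mat_def)
      have dep': "\<alpha> * (s (t k - \<tau>0) x * cis (\<omega>0 * t k)) + \<beta> * (s (t k - \<tau>) x * cis (\<omega> * t k)) = 0" if "k < N" for k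
        using dep[OF that] that by (simp add: sample_mat_def cis_conv_exp)
      \<comment> \<open>Otherwise \<open>\<alpha> \<noteq> 0\<close> would annihilate the first
        entry of the first column, which is almost surely nonzero.\<close>
      have "\<beta> \<noteq> 0"
      proof
        assume "\<beta> = 0"
        then show False using dep'[of 0] \<alpha>\<beta> elim(2) \<open>N \<ge> 3\<close> by simp
      qed
      have "sample_gap t (\<lambda>u. s u x) \<tau>0 \<tau> (\<omega> - \<omega>0) (- \<alpha> / \<beta>) k = 0" if "k < 3" for k
      proof -
        \<comment> \<open>Restoring the factor \<open>\<beta>\<close> and the phase removed in
          \<open>sample_gap\<close> recovers the dependence relation of row
          \<open>k\<close>.\<close>
        have "\<beta> * cis (\<omega> * t k) * sample_gap t (\<lambda>u. s u x) \<tau>0 \<tau> (\<omega> - \<omega>0) (- \<alpha> / \<beta>) k =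
            \<beta> * (s (t k - \<tau>) x * cis (\<omega> * t k)) + \<alpha> * (s (t k - \<tau>0) x * (cis (\<omega> * t k) * cis (- (\<omega> - \<omega>0) * t k)))"
          using \<open>\<beta> \<noteq> 0\<close> by (simp add: sample_gap_def field_simps)
        also have "cis (\<omega> * t k) * cis (- (\<omega> - \<omega>0) * t k) = cis (\<omega>0 * t k)"
          by (simp add: cis_mult algebra_simps)
        finally have "\<beta> * cis (\<omega> * t k) * sample_gap t (\<lambda>u. s u x) \<tau>0 \<tau> (\<omega> - \<omega>0) (- \<alpha> / \<beta>) k = 0"
          using dep'[of k] that \<open>N \<ge> 3\<close> by (simp add: add.commute)
        then show ?thesis using \<open>\<beta> \<noteq> 0\<close> by simp
      qed
      with elim(1) \<tau> assms(11) show False by blast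
    qed
  qed
qed

end
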